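(* Let $A$ and $B$ be one-generated connected graded $\mathbb K$-algebras. Let $n$ be a positive integer. Suppose that $t:(B\otimes A)_{\le n+1}\to(A\otimes B)_{\le n+1}$ is a graded $\mathbb K$-linear map such that $t$ satisfies the unital conditions $t(1\otimes a)=a\otimes 1$ and $t(b\otimes 1)=1\otimes b$, and (1) $t|_{(B\otimes A)_{\le n}}$ is graded twisting to degree $n$; (2) $t(1_B\otimes\mu_A)=(\mu_A\otimes 1_B)(1_A\otimes t)(t\otimes 1_A)$ on $(B\otimes A\otimes A_1)_{n+1}$; (3) $t(\mu_B\otimes 1_A)=(1_A\otimes\mu_B)(t\otimes 1_B)(1_B\otimes t)$ on $(B_1\otimes B\otimes A)_{n+1}$. Then $t$ is graded twisting to degree $n+1$.
   Context: $\mathbb K$ is a field, $\otimes=\otimes_{\mathbb K}$. Graded means $\mathbb N$-graded; algebras are associative and unital; connected means $A_0=\mathbb K1_A$. $A$ is one-generated if the canonical map $T(A_1)\to A$ is surjective. $\mu_A$ is the multiplication of $A$; $1_A$ also denotes the identity map of $A$. Tensor products of graded spaces are graded by $(V\otimes W)_m=\bigoplus_{k+l=m}V_k\otimes W_l$. A linear map is graded if it preserves degree; $f_n$ is its degree $n$ component, $f_{\le n}=\bigoplus_{i\le n}f_i$. A graded linear map $t:(B\otimes A)_{\le m}\to(A\otimes B)_{\le m}$ is graded twisting to degree $m$ if for each $i\le m$: $t(1_B\otimes a)=a\otimes 1_B$, $t(b\otimes 1_A)=1_A\otimes b$ for $a\in A_i$, $b\in B_i$, and $t_i(\mu_B\otimes\mu_A)=(\mu_A\otimes\mu_B)(1_A\otimes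 t_{\le i}\otimes 1_B)(t_{\le i}\otimes t_{\le i})(1_B\otimes t_{\le i}\otimes 1_A)$ on $(B\otimes B\otimes A\otimes A)_i$. *)

theory Defs
  imports Complex_Main "HOL-Library.Poly_Mapping" "HOL-Library.FuncSet"
begin

section \<open>Free vector spaces and their quotients\<close>

definition free_scale :: "'k::field \<Rightarrow> ('x \<Rightarrow>\<^sub>0 'k) \<Rightarrow> ('x \<Rightarrow>\<^sub>0 'k)" where
  "free_scale c p = Poly_Mapping.map (\<lambda>x. c * x) p"

definition free_extend ::
  "('k::field \<Rightarrow> 'u \<Rightarrow> 'u) \<Rightarrow> ('x \<Rightarrow> 'u::ab_group_add) \<Rightarrow> ('x \<Rightarrow>\<^sub>0 'k) \<Rightarrow> 'u" where
  "free_extend s h p = (\<Sum>x\<in>Poly_Mapping.keys p. s (Poly_Mapping.lookup p x) (h x))"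

text \<open>
  The quotient of a free vector space \<open>F\<close> by a subspace \<open>N\<close> is realised inside the same type by a
  linear choice of coset representatives: \<open>quot_proj N\<close> is a linear idempotent of \<open>F\<close> with kernel
  \<open>N\<close>, so its range is a copy of \<open>F / N\<close> and \<open>quot_proj N\<close> itself is the quotient map.  Existence is
  lemma \<open>quot_proj\<close>.
\<close>

definition quot_proj :: "('x \<Rightarrow>\<^sub>0 'k::field) set \<Rightarrow> ('x \<Rightarrow>\<^sub>0 'k) \<Rightarrow> ('x \<Rightarrow>\<^sub>0 'k)" where
  "quot_proj N = (SOME q. Vector_Spaces.linear free_scale free_scale q \<and>
     (\<forall>p. q (q p) = q p) \<and> (\<forall>p. q p = 0 \<longleftrightarrow> p \<in> N))"

lemma lookup_free_scale [simp]:
  "Poly_Mapping.lookup (free_scale c p) x = c * Poly_Mapping.lookup p x"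
  by (simp add: free_scale_def Poly_Mapping.map.rep_eq when_def)

lemma vector_space_free_scale: "vector_space (free_scale :: 'k::field \<Rightarrow> ('x \<Rightarrow>\<^sub>0 'k) \<Rightarrow> _)"
  by unfold_locales (auto intro!: poly_mapping_eqI simp: lookup_add algebra_simps)

lemma quot_proj:
  fixes N :: "('x \<Rightarrow>\<^sub>0 'k::field) set"
  assumes N: "module.subspace free_scale N"
  shows "Vector_Spaces.linear free_scale free_scale (quot_proj N)"
    and "quot_proj N (quot_proj N p) = quot_proj N p"
    and "quot_proj N p = 0 \<longleftrightarrow> p \<in> N"
proof -
  interpret V: vector_space "free_scale :: 'k \<Rightarrow> ('x \<Rightarrow>\<^sub>0 'k) \<Rightarrow> _"
    by (rule vector_space_free_scale)
  interpret P: vector_space_pair "free_scale :: 'k \<Rightarrow> ('x \<Rightarrow>\<^sub>0 'k) \<Rightarrow> _"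
    "free_scale :: 'k \<Rightarrow> ('x \<Rightarrow>\<^sub>0 'k) \<Rightarrow> _" ..
  have "\<exists>g. g ` UNIV \<subseteq> N \<and> Vector_Spaces.linear free_scale free_scale g \<and> (\<forall>v\<in>N. g (id v) = v)"
    by (rule P.linear_exists_left_inverse_on[OF V.linear_id N]) auto
  then obtain g where g: "\<And>p. g p \<in> N" "Vector_Spaces.linear free_scale free_scale g"
    "\<And>v. v \<in> N \<Longrightarrow> g v = v" by auto
  interpret g: Vector_Spaces.linear "free_scale :: 'k \<Rightarrow> ('x \<Rightarrow>\<^sub>0 'k) \<Rightarrow> _" free_scale g by (rule g)
  have ex: "\<exists>q. Vector_Spaces.linear free_scale free_scale q \<and>
     (\<forall>p. q (q p) = q p) \<and> (\<forall>p. q p = 0 \<longleftrightarrow> p \<in> N)"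
  proof (intro exI[of _ "\<lambda>p. p - g p"] conjI allI)
    show "Vector_Spaces.linear free_scale free_scale (\<lambda>p. p - g p)"
      by (rule P.linear_compose_sub[OF V.linear_ident g(2)])
    show "p - g p - g (p - g p) = p - g p" for p
      using g(1)[of p] g(3)[of "g p"] by (simp add: g.diff)
    show "p - g p = 0 \<longleftrightarrow> p \<in> N" for p using g(1)[of p] g(3)[of p] by auto
  qed
  note q = someI_ex[OF ex, folded quot_proj_def]
  show "Vector_Spaces.linear free_scale free_scale (quot_proj N)"
    and "quot_proj N (quot_proj N p) = quot_proj N p"
    and "quot_proj N p = 0 \<longleftrightarrow> p \<in> N" using q by auto
qed

lemma free_extend_superset:
  assumes "vector_space s" "finite S" "Poly_Mapping.keys p \<subseteq> S"
  shows "free_extend s h p = (\<Sum>x\<in>S. s (Poly_Mapping.lookup p x) (h x))"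
proof -
  interpret vector_space s by fact
  show ?thesis unfolding free_extend_def
    by (rule sum.mono_neutral_left) (use assms in \<open>auto simp: in_keys_iff\<close>)
qed

lemma linear_free_extend:
  fixes s :: "'k::field \<Rightarrow> 'u::ab_group_add \<Rightarrow> 'u" and h :: "'x \<Rightarrow> 'u"
  assumes "vector_space s"
  shows "Vector_Spaces.linear free_scale s (free_extend s h)"
proof -
  interpret S: vector_space s by fact
  interpret F: vector_space free_scale by (rule vector_space_free_scale)
  interpret P: vector_space_pair free_scale s ..
  show ?thesis
  proof unfold_locales
    fix p q :: "'x \<Rightarrow>\<^sub>0 'k"
    let ?S = "Poly_Mapping.keys p \<union> Poly_Mapping.keys q"
    have sub: "Poly_Mapping.keys (p + q) \<subseteq> ?S" by (rule Poly_Mapping.keys_add)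
    show "free_extend s h (p + q) = free_extend s h p + free_extend s h q"
      using sub by (simp add: free_extend_superset[OF assms, of ?S] lookup_add
          S.scale_left_distrib sum.distrib)
  next
    fix c and p :: "'x \<Rightarrow>\<^sub>0 'k"
    have sub: "Poly_Mapping.keys (free_scale c p) \<subseteq> Poly_Mapping.keys p"
      by (auto simp: in_keys_iff)
    show "free_extend s h (free_scale c p) = s c (free_extend s h p)"
      using sub by (simp add: free_extend_superset[OF assms, of "Poly_Mapping.keys p"]
          S.scale_sum_right)
  qed
qed

lemma free_extend_single:
  assumes "vector_space s"
  shows "free_extend s h (Poly_Mapping.single x c) = s c (h x)"
proof -
  interpret vector_space s by fact
  show ?thesis by (simp add: free_extend_superset[OF assms, of "{x}"])
qed


section \<open>Graded vector spaces and tensor products\<close>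

text \<open>
  The space underlying a graded space is the span of its homogeneous parts; it need not be the
  whole type.
\<close>

record ('k, 'v) graded_space =
  smul :: "'k \<Rightarrow> 'v \<Rightarrow> 'v"
  part :: "nat \<Rightarrow> 'v set"

definition part_upto :: "('k::field, 'v::ab_group_add) graded_space \<Rightarrow> nat \<Rightarrow> 'v set" where
  "part_upto V m = module.span (smul V) (\<Union>i\<le>m. part V i)"

definition tensor_relations ::
  "('k::field, 'v::ab_group_add) graded_space \<Rightarrow> ('k, 'w::ab_group_add) graded_space \<Rightarrow>
   ('v \<times> 'w \<Rightarrow>\<^sub>0 'k) set" where
  "tensor_relations V W = (let e = (\<lambda>v w. Poly_Mapping.single (v, w) (1::'k)) in
     module.span free_scale
      ({e (v + v') w - e v w - e v' w | v v' w. True} \<union>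
       {e v (w + w') - e v w - e v w' | v w w'. True} \<union>
       {e (smul V c v) w - free_scale c (e v w) | c v w. True} \<union>
       {e v (smul W c w) - free_scale c (e v w) | c v w. True}))"

definition tens ::
  "('k::field, 'v::ab_group_add) graded_space \<Rightarrow> ('k, 'w::ab_group_add) graded_space \<Rightarrow>
   'v \<Rightarrow> 'w \<Rightarrow> ('v \<times> 'w \<Rightarrow>\<^sub>0 'k)" where
  "tens V W v w = quot_proj (tensor_relations V W) (Poly_Mapping.single (v, w) 1)"

text \<open>
  For subspaces \<open>S\<close> and \<open>T\<close>, the tensor product of \<open>S\<close> and \<open>T\<close> is identified with the span of the
  elements \<open>tens V W s t\<close> for \<open>s \<in> S\<close>, \<open>t \<in> T\<close>; over a field the canonical map between the two is
  an isomorphism.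
\<close>

definition tensor ::
  "('k::field, 'v::ab_group_add) graded_space \<Rightarrow> ('k, 'w::ab_group_add) graded_space \<Rightarrow>
   ('k, 'v \<times> 'w \<Rightarrow>\<^sub>0 'k) graded_space" (infixr \<open>\<otimes>\<close> 70) where
  "V \<otimes> W = \<lparr> smul = free_scale,
     part = (\<lambda>m. module.span free_scale
       (\<Union>k\<le>m. {tens V W v w | v w. v \<in> part V k \<and> w \<in> part W (m - k)})) \<rparr>"

text \<open>
  The linear map induced by a bilinear map \<open>h\<close> with values in a space with scalar multiplication
  \<open>s\<close>; see \<open>tensor_lift_tens\<close> and \<open>tensor_lift_unique\<close>.
\<close>

definition tensor_lift ::
  "('k::field \<Rightarrow> 'u \<Rightarrow> 'u) \<Rightarrow> ('v \<Rightarrow> 'w \<Rightarrow> 'u::ab_group_add) \<Rightarrow> ('v \<times> 'w \<Rightarrow>\<^sub>0 'k) \<Rightarrow> 'u" where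
  "tensor_lift s h = free_extend s (\<lambda>(v, w). h v w)"

definition tensor_map ::
  "('k::field, 'v1::ab_group_add) graded_space \<Rightarrow> ('k, 'w1::ab_group_add) graded_space \<Rightarrow>
   ('v \<Rightarrow> 'v1) \<Rightarrow> ('w \<Rightarrow> 'w1) \<Rightarrow> ('v \<times> 'w \<Rightarrow>\<^sub>0 'k) \<Rightarrow> ('v1 \<times> 'w1 \<Rightarrow>\<^sub>0 'k)" where
  "tensor_map V1 W1 f g = tensor_lift free_scale (\<lambda>v w. tens V1 W1 (f v) (g w))"

text \<open>\<open>(U \<otimes> V) \<otimes> W \<rightarrow> U \<otimes> (V \<otimes> W)\<close> and its inverse\<close>

definition assoc_right ::
  "('k::field, 'u::ab_group_add) graded_space \<Rightarrow> ('k, 'v::ab_group_add) graded_space \<Rightarrow>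
   ('k, 'w::ab_group_add) graded_space \<Rightarrow>
   (('u \<times> 'v \<Rightarrow>\<^sub>0 'k) \<times> 'w \<Rightarrow>\<^sub>0 'k) \<Rightarrow> ('u \<times> ('v \<times> 'w \<Rightarrow>\<^sub>0 'k) \<Rightarrow>\<^sub>0 'k)" where
  "assoc_right U V W = tensor_lift free_scale
     (\<lambda>p w. tensor_lift free_scale (\<lambda>u v. tens U (V \<otimes> W) u (tens V W v w)) p)"

definition assoc_left ::
  "('k::field, 'u::ab_group_add) graded_space \<Rightarrow> ('k, 'v::ab_group_add) graded_space \<Rightarrow>
   ('k, 'w::ab_group_add) graded_space \<Rightarrow>
   ('u \<times> ('v \<times> 'w \<Rightarrow>\<^sub>0 'k) \<Rightarrow>\<^sub>0 'k) \<Rightarrow> (('u \<times> 'v \<Rightarrow>\<^sub>0 'k) \<times> 'w \<Rightarrow>\<^sub>0 'k)" where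
  "assoc_left U V W = tensor_lift free_scale
     (\<lambda>u p. tensor_lift free_scale (\<lambda>v w. tens (U \<otimes> V) W (tens U V u v) w) p)"

text \<open>
  \<open>1\<^sub>U \<otimes> f \<otimes> 1\<^sub>X\<close> for \<open>f : V \<otimes> W \<rightarrow> W \<otimes> V\<close>, bracketed as a map
  \<open>(U \<otimes> V) \<otimes> (W \<otimes> X) \<rightarrow> (U \<otimes> W) \<otimes> (V \<otimes> X)\<close>
\<close>

definition tensor_middle ::
  "('k::field, 'u::ab_group_add) graded_space \<Rightarrow> ('k, 'v::ab_group_add) graded_space \<Rightarrow>
   ('k, 'w::ab_group_add) graded_space \<Rightarrow> ('k, 'x::ab_group_add) graded_space \<Rightarrow>
   (('v \<times> 'w \<Rightarrow>\<^sub>0 'k) \<Rightarrow> ('w \<times> 'v \<Rightarrow>\<^sub>0 'k)) \<Rightarrow>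
   (('u \<times> 'v \<Rightarrow>\<^sub>0 'k) \<times> ('w \<times> 'x \<Rightarrow>\<^sub>0 'k) \<Rightarrow>\<^sub>0 'k) \<Rightarrow>
   (('u \<times> 'w \<Rightarrow>\<^sub>0 'k) \<times> ('v \<times> 'x \<Rightarrow>\<^sub>0 'k) \<Rightarrow>\<^sub>0 'k)" where
  "tensor_middle U V W X f =
     assoc_left U W (V \<otimes> X) \<circ>
     tensor_map U (W \<otimes> V \<otimes> X) id
       (assoc_right W V X \<circ> tensor_map (W \<otimes> V) X f id \<circ> assoc_left V W X) \<circ>
     assoc_right U V (W \<otimes> X)"


subsection \<open>Universal property\<close>

definition bilinear_map ::
  "('k::field \<Rightarrow> 'v \<Rightarrow> 'v) \<Rightarrow> ('k \<Rightarrow> 'w \<Rightarrow> 'w) \<Rightarrow> ('k \<Rightarrow> 'u \<Rightarrow> 'u) \<Rightarrow>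
   ('v::ab_group_add \<Rightarrow> 'w::ab_group_add \<Rightarrow> 'u::ab_group_add) \<Rightarrow> bool" where
  "bilinear_map s1 s2 s3 h \<longleftrightarrow>
     (\<forall>v v' w. h (v + v') w = h v w + h v' w) \<and> (\<forall>v w w'. h v (w + w') = h v w + h v w') \<and>
     (\<forall>c v w. h (s1 c v) w = s3 c (h v w)) \<and> (\<forall>c v w. h v (s2 c w) = s3 c (h v w))"

lemma subspace_tensor_relations: "module.subspace free_scale (tensor_relations V W)"
proof -
  interpret F: vector_space free_scale by (rule vector_space_free_scale)
  show ?thesis by (simp add: tensor_relations_def Let_def)
qed

lemma bilinear_tens: "bilinear_map (smul V) (smul W) free_scale (tens V W)"
proof -
  interpret F: vector_space free_scale by (rule vector_space_free_scale)
  note Q = quot_proj[OF subspace_tensor_relations[of V W]]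
  interpret Q: Vector_Spaces.linear free_scale free_scale "quot_proj (tensor_relations V W)"
    by (rule Q)
  let ?e = "\<lambda>v w. Poly_Mapping.single (v, w) 1"
  have 1: "?e (v + v') w - ?e v w - ?e v' w \<in> tensor_relations V W" for v v' w
    unfolding tensor_relations_def Let_def by (rule F.span_base) blast
  have 2: "?e v (w + w') - ?e v w - ?e v w' \<in> tensor_relations V W" for v w w'
    unfolding tensor_relations_def Let_def by (rule F.span_base) blast
  have 3: "?e (smul V c v) w - free_scale c (?e v w) \<in> tensor_relations V W" for c v w
    unfolding tensor_relations_def Let_def by (rule F.span_base) blast
  have 4: "?e v (smul W c w) - free_scale c (?e v w) \<in> tensor_relations V W" for c v w
    unfolding tensor_relations_def Let_def by (rule F.span_base) blast
  show ?thesis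
    using 1 2 3 4 unfolding Q(3)[symmetric] bilinear_map_def tens_def
    by (simp add: Q.diff Q.scale Q.add algebra_simps)
qed

lemma linear_tensor_lift:
  "vector_space s \<Longrightarrow> Vector_Spaces.linear free_scale s (tensor_lift s h)"
  unfolding tensor_lift_def by (rule linear_free_extend)

lemma tensor_lift_tens:
  assumes s: "vector_space s" and h: "bilinear_map (smul V) (smul W) s h"
  shows "tensor_lift s h (tens V W v w) = h v w"
proof -
  interpret S: vector_space s by fact
  interpret F: vector_space free_scale by (rule vector_space_free_scale)
  interpret L: Vector_Spaces.linear free_scale s "tensor_lift s h"
    by (rule linear_tensor_lift[OF s])
  let ?N = "tensor_relations V W"
  note Q = quot_proj[OF subspace_tensor_relations[of V W]]
  interpret Q: Vector_Spaces.linear free_scale free_scale "quot_proj ?N" by (rule Q)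
  let ?e = "\<lambda>v w. Poly_Mapping.single (v, w) 1"
  have e: "tensor_lift s h (?e v w) = h v w" for v w
    by (simp add: tensor_lift_def free_extend_single[OF s])
  have sub: "F.subspace {p. tensor_lift s h p = 0}"
    by (rule F.subspaceI) (auto simp: L.add L.scale)
  have kill: "tensor_lift s h p = 0" if "p \<in> ?N" for p
  proof -
    have "?N \<subseteq> {p. tensor_lift s h p = 0}"
      unfolding tensor_relations_def Let_def
      by (rule F.span_minimal[OF _ sub])
         (use h in \<open>auto simp: L.diff L.scale e bilinear_map_def\<close>)
    with that show ?thesis by auto
  qed
  have "?e v w - quot_proj ?N (?e v w) \<in> ?N"
    using Q(2,3) by (simp add: Q.diff flip: Q(3))
  from kill[OF this] show ?thesis by (simp add: L.diff e tens_def)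
qed

lemma tensor_lift_unique:
  assumes s: "vector_space s" and h: "bilinear_map (smul V) (smul W) s h"
    and f: "Vector_Spaces.linear free_scale s f" "\<And>v w. f (tens V W v w) = h v w"
    and p: "p \<in> module.span free_scale {tens V W v w | v w. True}"
  shows "f p = tensor_lift s h p"
proof -
  interpret S: vector_space s by fact
  interpret F: vector_space free_scale by (rule vector_space_free_scale)
  interpret P: vector_space_pair free_scale s ..
  show ?thesis
    by (rule P.linear_eq_on[OF f(1) linear_tensor_lift[OF s] p])
       (auto simp: f(2) tensor_lift_tens[OF s h])
qed


section \<open>Graded algebras\<close>

text \<open>
  The sort \<open>{ring, one}\<close> rather than \<open>ring_1\<close> is used because the latter excludes the zero algebra.
\<close>

locale graded_algebra =
  fixes A :: "('k::field, 'a::{ring, one}) graded_space"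
  assumes vector_space: "vector_space (smul A)"
    and smul_mult_left: "smul A c (x * y) = smul A c x * y"
    and smul_mult_right: "smul A c (x * y) = x * smul A c y"
    and mult_one_left: "1 * x = x"
    and mult_one_right: "x * 1 = x"
    and subspace_part: "module.subspace (smul A) (part A i)"
    and decomposition:
      "\<exists>!f. (\<forall>i. f i \<in> part A i) \<and> finite {i. f i \<noteq> 0} \<and> x = (\<Sum>i | f i \<noteq> 0. f i)"
    and one_part: "1 \<in> part A 0"
    and mult_part: "x \<in> part A i \<Longrightarrow> y \<in> part A j \<Longrightarrow> x * y \<in> part A (i + j)"

locale connected_graded_algebra = graded_algebra +
  assumes connected: "part A 0 = range (\<lambda>c. smul A c 1)"

definition component :: "('k, 'a::ab_group_add) graded_space \<Rightarrow> nat \<Rightarrow> 'a \<Rightarrow> 'a" where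
  "component A k x =
     (THE f. (\<forall>i. f i \<in> part A i) \<and> finite {i. f i \<noteq> 0} \<and> x = (\<Sum>i | f i \<noteq> 0. f i)) k"

definition mult_map :: "('k::field, 'a::{ring, one}) graded_space \<Rightarrow> ('a \<times> 'a \<Rightarrow>\<^sub>0 'k) \<Rightarrow> 'a" where
  "mult_map A = tensor_lift (smul A) (*)"

text \<open>
  The tensor algebra of a subspace \<open>V\<close>: the free vector space on words in \<open>V\<close> modulo
  multilinearity in the letters.
\<close>

definition tensor_algebra_relations ::
  "('k::field \<Rightarrow> 'a \<Rightarrow> 'a) \<Rightarrow> 'a::ab_group_add set \<Rightarrow> ('a list \<Rightarrow>\<^sub>0 'k) set" where
  "tensor_algebra_relations s V = (let e = (\<lambda>xs. Poly_Mapping.single xs (1::'k)) in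
     module.span free_scale
      ({e (xs @ (v + v') # ys) - e (xs @ v # ys) - e (xs @ v' # ys) | xs ys v v'.
          xs \<in> lists V \<and> ys \<in> lists V \<and> v \<in> V \<and> v' \<in> V} \<union>
       {e (xs @ s c v # ys) - free_scale c (e (xs @ v # ys)) | xs ys c v.
          xs \<in> lists V \<and> ys \<in> lists V \<and> v \<in> V}))"

definition tensor_algebra ::
  "('k::field \<Rightarrow> 'a \<Rightarrow> 'a) \<Rightarrow> 'a::ab_group_add set \<Rightarrow> ('a list \<Rightarrow>\<^sub>0 'k) set" where
  "tensor_algebra s V =
     quot_proj (tensor_algebra_relations s V) ` {p. Poly_Mapping.keys p \<subseteq> lists V}"

definition tensor_algebra_map ::
  "('k::field, 'a::{ring, one}) graded_space \<Rightarrow> ('a list \<Rightarrow>\<^sub>0 'k) \<Rightarrow> 'a" where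
  "tensor_algebra_map A = free_extend (smul A) (\<lambda>xs. foldr (*) xs 1)"

definition one_generated :: "('k::field, 'a::{ring, one}) graded_space \<Rightarrow> bool" where
  "one_generated A \<longleftrightarrow> tensor_algebra_map A ` tensor_algebra (smul A) (part A 1) = UNIV"

definition degree_one_part ::
  "('k, 'a::ab_group_add) graded_space \<Rightarrow> ('k, 'a) graded_space" where
  "degree_one_part A = A\<lparr>part := (\<lambda>k. if k = 1 then part A 1 else {0})\<rparr>"


section \<open>Graded twisting maps\<close>

definition graded_linear_upto ::
  "('k::field, 'v::ab_group_add) graded_space \<Rightarrow> ('k, 'w::ab_group_add) graded_space \<Rightarrow> nat \<Rightarrow>
   ('v \<Rightarrow> 'w) \<Rightarrow> bool" where
  "graded_linear_upto V W m f \<longleftrightarrow>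
     (\<forall>x\<in>part_upto V m. \<forall>y\<in>part_upto V m. f (x + y) = f x + f y) \<and>
     (\<forall>c. \<forall>x\<in>part_upto V m. f (smul V c x) = smul W c (f x)) \<and>
     (\<forall>i\<le>m. f ` part V i \<subseteq> part W i)"

text \<open>
  The truncation of \<open>t\<close> to degrees \<open>\<le> i\<close>, extended by zero to the higher degrees of the tensor
  product of \<open>B\<close> and \<open>A\<close> so that it can be tensored with other maps.
\<close>

definition truncation ::
  "('k::field, 'b::ab_group_add) graded_space \<Rightarrow> ('k, 'a::ab_group_add) graded_space \<Rightarrow> nat \<Rightarrow>
   (('b \<times> 'a \<Rightarrow>\<^sub>0 'k) \<Rightarrow> ('a \<times> 'b \<Rightarrow>\<^sub>0 'k)) \<Rightarrow> ('b \<times> 'a \<Rightarrow>\<^sub>0 'k) \<Rightarrow> ('a \<times> 'b \<Rightarrow>\<^sub>0 'k)" where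
  "truncation B A i t = tensor_lift free_scale
     (\<lambda>b a. \<Sum>k\<le>i. \<Sum>l\<le>i - k. t (tens B A (component B k b) (component A l a)))"

definition unital_upto ::
  "('k::field, 'b::{ring, one}) graded_space \<Rightarrow> ('k, 'a::{ring, one}) graded_space \<Rightarrow> nat \<Rightarrow>
   (('b \<times> 'a \<Rightarrow>\<^sub>0 'k) \<Rightarrow> ('a \<times> 'b \<Rightarrow>\<^sub>0 'k)) \<Rightarrow> bool" where
  "unital_upto B A m t \<longleftrightarrow> (\<forall>i\<le>m.
     (\<forall>a\<in>part A i. t (tens B A 1 a) = tens A B a 1) \<and>
     (\<forall>b\<in>part B i. t (tens B A b 1) = tens A B 1 b))"

definition graded_twisting ::
  "('k::field, 'b::{ring, one}) graded_space \<Rightarrow> ('k, 'a::{ring, one}) graded_space \<Rightarrow> nat \<Rightarrow>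
   (('b \<times> 'a \<Rightarrow>\<^sub>0 'k) \<Rightarrow> ('a \<times> 'b \<Rightarrow>\<^sub>0 'k)) \<Rightarrow> bool" where
  "graded_twisting B A m t \<longleftrightarrow>
     graded_linear_upto (B \<otimes> A) (A \<otimes> B) m t \<and> unital_upto B A m t \<and>
     (\<forall>i\<le>m. \<forall>x\<in>part ((B \<otimes> B) \<otimes> (A \<otimes> A)) i.
        t (tensor_map B A (mult_map B) (mult_map A) x) =
        (tensor_map A B (mult_map A) (mult_map B) \<circ>
         tensor_middle A B A B (truncation B A i t) \<circ>
         tensor_map (A \<otimes> B) (A \<otimes> B) (truncation B A i t) (truncation B A i t) \<circ>
         tensor_middle B B A A (truncation B A i t)) x)"


subsection \<open>Consistency of the structure maps\<close>

lemma vector_space_smul_tensor: "vector_space (smul (V \<otimes> W))"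
  by (simp add: tensor_def vector_space_free_scale)

lemma tensor_map_tens:
  assumes "Vector_Spaces.linear (smul V) (smul V1) f" "Vector_Spaces.linear (smul W) (smul W1) g"
  shows "tensor_map V1 W1 f g (tens V W v w) = tens V1 W1 (f v) (g w)"
proof -
  interpret f: Vector_Spaces.linear "smul V" "smul V1" f by fact
  interpret g: Vector_Spaces.linear "smul W" "smul W1" g by fact
  show ?thesis unfolding tensor_map_def
    by (rule tensor_lift_tens[OF vector_space_free_scale])
       (use bilinear_tens[of V1 W1] in
         \<open>simp add: bilinear_map_def f.add g.add f.scale g.scale\<close>)
qed

lemma assoc_right_tens:
  "assoc_right U V W (tens (U \<otimes> V) W (tens U V u v) w) = tens U (V \<otimes> W) u (tens V W v w)"
proof -
  interpret F: vector_space "free_scale" by (rule vector_space_free_scale)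
  let ?h = "\<lambda>w u v. tens U (V \<otimes> W) u (tens V W v w)"
  have s: "smul (X \<otimes> Y) = free_scale" for X Y by (simp add: tensor_def)
  note b = bilinear_tens[of U "V \<otimes> W", unfolded s bilinear_map_def]
    bilinear_tens[of V W, unfolded bilinear_map_def]
  have h: "bilinear_map (smul U) (smul V) free_scale (?h w)" for w
    using b by (simp add: bilinear_map_def)
  have "bilinear_map (smul (U \<otimes> V)) (smul W) free_scale (\<lambda>p w. tensor_lift free_scale (?h w) p)"
    unfolding bilinear_map_def s
  proof (intro conjI allI)
    fix p p' w w' c
    interpret L: Vector_Spaces.linear free_scale free_scale "tensor_lift free_scale (?h w)"
      by (rule linear_tensor_lift[OF vector_space_free_scale])
    show "tensor_lift free_scale (?h w) (p + p') =
        tensor_lift free_scale (?h w) p + tensor_lift free_scale (?h w) p'" by (rule L.add)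
    show "tensor_lift free_scale (?h w) (free_scale c p) =
        free_scale c (tensor_lift free_scale (?h w) p)" by (rule L.scale)
    show "tensor_lift free_scale (?h (w + w')) p =
        tensor_lift free_scale (?h w) p + tensor_lift free_scale (?h w') p"
      using b by (simp add: tensor_lift_def free_extend_def case_prod_unfold sum.distrib
          F.scale_right_distrib)
    show "tensor_lift free_scale (?h (smul W c w)) p =
        free_scale c (tensor_lift free_scale (?h w) p)"
      using b by (simp add: tensor_lift_def free_extend_def case_prod_unfold F.scale_sum_right
          mult.commute)
  qed
  then show ?thesis
    by (simp add: assoc_right_def tensor_lift_tens[OF vector_space_free_scale]
        tensor_lift_tens[OF vector_space_free_scale h])
qed

lemma assoc_left_tens:
  "assoc_left U V W (tens U (V \<otimes> W) u (tens V W v w)) = tens (U \<otimes> V) W (tens U V u v) w"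
proof -
  interpret F: vector_space "free_scale" by (rule vector_space_free_scale)
  let ?h = "\<lambda>u v w. tens (U \<otimes> V) W (tens U V u v) w"
  have s: "smul (X \<otimes> Y) = free_scale" for X Y by (simp add: tensor_def)
  note b = bilinear_tens[of "U \<otimes> V" W, unfolded s bilinear_map_def]
    bilinear_tens[of U V, unfolded bilinear_map_def]
  have h: "bilinear_map (smul V) (smul W) free_scale (?h u)" for u
    using b by (simp add: bilinear_map_def)
  have "bilinear_map (smul U) (smul (V \<otimes> W)) free_scale (\<lambda>u p. tensor_lift free_scale (?h u) p)"
    unfolding bilinear_map_def s
  proof (intro conjI allI)
    fix p p' u u' c
    interpret L: Vector_Spaces.linear free_scale free_scale "tensor_lift free_scale (?h u)"
      by (rule linear_tensor_lift[OF vector_space_free_scale])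
    show "tensor_lift free_scale (?h u) (p + p') =
        tensor_lift free_scale (?h u) p + tensor_lift free_scale (?h u) p'" by (rule L.add)
    show "tensor_lift free_scale (?h u) (free_scale c p) =
        free_scale c (tensor_lift free_scale (?h u) p)" by (rule L.scale)
    show "tensor_lift free_scale (?h (u + u')) p =
        tensor_lift free_scale (?h u) p + tensor_lift free_scale (?h u') p"
      using b by (simp add: tensor_lift_def free_extend_def case_prod_unfold sum.distrib
          F.scale_right_distrib)
    show "tensor_lift free_scale (?h (smul U c u)) p =
        free_scale c (tensor_lift free_scale (?h u) p)"
      using b by (simp add: tensor_lift_def free_extend_def case_prod_unfold F.scale_sum_right
          mult.commute)
  qed
  then show ?thesis
    by (simp add: assoc_left_def tensor_lift_tens[OF vector_space_free_scale]
        tensor_lift_tens[OF vector_space_free_scale h])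
qed

lemma mult_map_tens:
  assumes "graded_algebra A"
  shows "mult_map A (tens A A x y) = x * y"
proof -
  interpret graded_algebra A by fact
  show ?thesis unfolding mult_map_def
    by (rule tensor_lift_tens[OF vector_space])
       (simp add: bilinear_map_def distrib_left distrib_right flip: smul_mult_left smul_mult_right)
qed

context graded_algebra
begin

interpretation A: vector_space "smul A" by (rule vector_space)

lemma component_unique:
  assumes "\<And>i. f i \<in> part A i" "finite S" "\<And>i. i \<notin> S \<Longrightarrow> f i = 0" "x = sum f S"
  shows "component A k x = f k"
proof -
  have sub: "{i. f i \<noteq> 0} \<subseteq> S" using assms(3) by blast
  have "(\<Sum>i | f i \<noteq> 0. f i) = sum f S"
    by (rule sum.mono_neutral_left) (use assms(2) sub in auto)
  then have "(\<forall>i. f i \<in> part A i) \<and> finite {i. f i \<noteq> 0} \<and> x = (\<Sum>i | f i \<noteq> 0. f i)"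
    using assms finite_subset[OF sub] by auto
  then have "(THE f. (\<forall>i. f i \<in> part A i) \<and> finite {i. f i \<noteq> 0} \<and> x = (\<Sum>i | f i \<noteq> 0. f i)) = f"
    by (rule the1_equality[OF decomposition])
  then show ?thesis unfolding component_def by simp
qed

lemma component_decomposition:
  "component A i x \<in> part A i" "finite {i. component A i x \<noteq> 0}"
  "x = (\<Sum>i | component A i x \<noteq> 0. component A i x)"
proof -
  from theI'[OF decomposition[of x]]
  show "component A i x \<in> part A i" "finite {i. component A i x \<noteq> 0}"
    "x = (\<Sum>i | component A i x \<noteq> 0. component A i x)"
    unfolding component_def by auto
qed

lemma component_part:
  assumes "x \<in> part A i"
  shows "component A k x = (if k = i then x else 0)"
  by (rule component_unique[where S = "{i}"])
     (use assms A.subspace_0[OF subspace_part] in auto)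

lemma component_add: "component A k (x + y) = component A k x + component A k y"
proof (rule component_unique[where S = "{i. component A i x \<noteq> 0} \<union> {i. component A i y \<noteq> 0}"])
  let ?S = "{i. component A i x \<noteq> 0} \<union> {i. component A i y \<noteq> 0}"
  note D = component_decomposition
  have "x = (\<Sum>i\<in>?S. component A i x)"
    by (subst D(3)[of x], rule sum.mono_neutral_left) (use D(2) in auto)
  moreover have "y = (\<Sum>i\<in>?S. component A i y)"
    by (subst D(3)[of y], rule sum.mono_neutral_left) (use D(2) in auto)
  ultimately show "x + y = (\<Sum>i\<in>?S. component A i x + component A i y)"
    by (simp add: sum.distrib)
qed (auto intro: A.subspace_add[OF subspace_part] component_decomposition)

lemma component_smul: "component A k (smul A c x) = smul A c (component A k x)"
proof (rule component_unique[where S = "{i. component A i x \<noteq> 0}"])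
  show "smul A c x = (\<Sum>i | component A i x \<noteq> 0. smul A c (component A i x))"
    by (subst component_decomposition(3)[of x]) (simp add: A.scale_sum_right)
qed (auto intro: A.subspace_scale[OF subspace_part] component_decomposition)

end

lemma truncation_part:
  assumes B: "graded_algebra B" and A: "graded_algebra A"
    and t: "graded_linear_upto (B \<otimes> A) C m t" and C: "smul C = free_scale"
    and i: "j \<le> i" "i \<le> m" and x: "x \<in> part (B \<otimes> A) j"
  shows "truncation B A i t x = t x"
proof -
  interpret F: vector_space free_scale by (rule vector_space_free_scale)
  interpret B: graded_algebra B by fact
  interpret A: graded_algebra A by fact
  interpret L: Vector_Spaces.linear free_scale free_scale "truncation B A i t"
    unfolding truncation_def by (rule linear_tensor_lift[OF vector_space_free_scale])
  let ?T = "part_upto (B \<otimes> A) m"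
  have s: "smul (B \<otimes> A) = free_scale" by (simp add: tensor_def)
  have subT: "F.subspace ?T" by (simp add: part_upto_def s)
  have partT: "part (B \<otimes> A) l \<subseteq> ?T" if "l \<le> m" for l
    unfolding part_upto_def s using that by (auto intro: F.span_base)
  have tT: "tens B A b a \<in> ?T" if "b \<in> part B k" "a \<in> part A l" "k + l \<le> m" for a b k l
  proof -
    have "tens B A b a \<in> part (B \<otimes> A) (k + l)"
      unfolding tensor_def graded_space.simps
      by (rule F.span_base, rule UN_I[of k]) (use that in \<open>simp, fastforce\<close>)
    with partT that show ?thesis by blast
  qed
  have tadd: "t (p + q) = t p + t q" if "p \<in> ?T" "q \<in> ?T" for p q
    using t that by (auto simp: graded_linear_upto_def)
  have tsc: "t (free_scale c p) = free_scale c (t p)" if "p \<in> ?T" for p c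
    using t that by (auto simp: graded_linear_upto_def s C)
  have t0: "t 0 = 0" using tadd[OF F.subspace_0[OF subT] F.subspace_0[OF subT]] by simp
  note b = bilinear_tens[of B A, unfolded bilinear_map_def]
  have zero: "tens B A 0 a = 0" "tens B A b 0 = 0" for a b
    using b by (metis add_cancel_left_left add.left_neutral)+
  let ?h = "\<lambda>b a. \<Sum>k\<le>i. \<Sum>l\<le>i - k. t (tens B A (component B k b) (component A l a))"
  have "bilinear_map (smul B) (smul A) free_scale ?h"
    unfolding bilinear_map_def
    by (use b i in \<open>auto simp: A.component_add B.component_add A.component_smul B.component_smul
          F.scale_sum_right sum.distrib[symmetric] tadd[symmetric] tsc[symmetric]
          intro!: sum.cong tadd tsc tT A.component_decomposition B.component_decomposition\<close>)
  then have lift: "truncation B A i t (tens B A b a) = ?h b a" for b a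
    unfolding truncation_def by (rule tensor_lift_tens[OF vector_space_free_scale])
  have gen: "truncation B A i t (tens B A b a) = t (tens B A b a)"
    if "k \<le> j" "b \<in> part B k" "a \<in> part A (j - k)" for b a k
  proof -
    have "?h b a = (\<Sum>k'\<le>i. \<Sum>l\<le>i - k'. if l = j - k then (if k' = k then t (tens B A b a) else 0) else 0)"
      by (intro sum.cong) (auto simp: B.component_part[OF that(2)] A.component_part[OF that(3)] zero t0)
    also have "\<dots> = (\<Sum>k'\<le>i. if k' = k then t (tens B A b a) else 0)"
      using that i by (intro sum.cong) (auto simp: sum.delta)
    also have "\<dots> = t (tens B A b a)" using that i by (simp add: sum.delta)
    finally show ?thesis by (simp add: lift)
  qed
  have "F.subspace {p \<in> ?T. truncation B A i t p = t p}"
    by (rule F.subspaceI)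
       (auto simp: t0 tadd tsc L.add L.scale
         intro: F.subspace_0[OF subT] F.subspace_add[OF subT] F.subspace_scale[OF subT])
  moreover have "tens B A b a \<in> ?T" if "k \<le> j" "b \<in> part B k" "a \<in> part A (j - k)" for b a k
    using tT[OF that(2,3)] that i by auto
  ultimately have "part (B \<otimes> A) j \<subseteq> {p \<in> ?T. truncation B A i t p = t p}"
    unfolding tensor_def graded_space.simps
    by (intro F.span_minimal) (use gen in \<open>auto simp: tensor_def\<close>)
  with x show ?thesis by blast
qed

end

theory Submission
  imports Defs
begin

text \<open>
  The twisting condition in degree \<open>m\<close> is equivalent, given the unital conditions, to the two
  hexagon-type rules
  \<open>R: t(1 \<otimes> \<mu>) = (\<mu> \<otimes> 1)(1 \<otimes> t)(t \<otimes> 1)\<close> and \<open>L: t(\<mu> \<otimes> 1) = (1 \<otimes> \<mu>)(t \<otimes> 1)(1 \<otimes> t)\<close> holding up to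
  degree \<open>m\<close>: setting one of the inner factors to \<open>1\<close> gives \<open>R\<close> and \<open>L\<close>, and conversely one expands
  \<open>t(bb' \<otimes> aa')\<close> by \<open>R\<close>, then by \<open>L\<close> twice.  It therefore suffices to extend \<open>R\<close> from
  \<open>B \<otimes> A \<otimes> A\<^sub>1\<close> to \<open>B \<otimes> A \<otimes> A\<close>, and symmetrically for \<open>L\<close>.  Since \<open>A\<close> is one-generated, this is an
  induction on the degree of the last factor: for \<open>a' = cx\<close> with \<open>x\<close> of degree one,
  \<open>t(b \<otimes> acx)\<close> is computed by moving first \<open>b\<close> past \<open>ac\<close> and then the result past \<open>x\<close>.
\<close>

section \<open>Linear maps on tensor products\<close>

lemma linear_comp:
  "Vector_Spaces.linear s2 s3 g \<Longrightarrow> Vector_Spaces.linear s1 s2 f \<Longrightarrow>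
   Vector_Spaces.linear s1 s3 (\<lambda>x. g (f x))"
  using Vector_Spaces.linear_compose[of s1 s2 f s3 g] by (simp add: o_def)

lemma linear_id': "vector_space s \<Longrightarrow> Vector_Spaces.linear s s (\<lambda>x. x)"
  by (rule vector_space.linear_ident)

lemma linearI:
  assumes "vector_space s1" "vector_space s2"
    and "\<And>x y. f (x + y) = f x + f y" "\<And>c x. f (s1 c x) = s2 c (f x)"
  shows "Vector_Spaces.linear s1 s2 f"
  using assms
  by (simp add: Vector_Spaces.linear_def module_hom_def module_hom_axioms_def module_iff_vector_space)

lemma linear_addD: "Vector_Spaces.linear s1 s2 f \<Longrightarrow> f (x + y) = f x + f y"
  by (rule module_hom.add[OF Vector_Spaces.linear.axioms(3)])

lemma linear_scaleD: "Vector_Spaces.linear s1 s2 f \<Longrightarrow> f (s1 c x) = s2 c (f x)"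
  by (rule module_hom.scale[OF Vector_Spaces.linear.axioms(3)])

lemma linear_vector_spaces:
  assumes "Vector_Spaces.linear s1 s2 f"
  shows "vector_space s1" "vector_space s2"
  using assms by (simp_all add: Vector_Spaces.linear_def)

lemma smul_tensor [simp]: "smul (V \<otimes> W) = free_scale"
  by (simp add: tensor_def)

lemma bilinear_mapI:
  assumes "\<And>w. Vector_Spaces.linear s1 s3 (\<lambda>v. h v w)" "\<And>v. Vector_Spaces.linear s2 s3 (h v)"
  shows "bilinear_map s1 s2 s3 h"
  unfolding bilinear_map_def
  using linear_addD[OF assms(1)] linear_addD[OF assms(2)]
    linear_scaleD[OF assms(1)] linear_scaleD[OF assms(2)] by blast

lemma linear_lift_arg:
  assumes "vector_space s" "Vector_Spaces.linear s1 free_scale f"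
  shows "Vector_Spaces.linear s1 s (\<lambda>x. tensor_lift s h (f x))"
  by (rule linear_comp[OF linear_tensor_lift[OF assms(1)] assms(2)])

text \<open>For fixed \<open>p\<close>, \<open>tensor_lift\<close> is a finite sum over the keys of
  \<open>p\<close>, so linearity in a parameter of \<open>h\<close> can be checked key by
  key.\<close>

lemma linear_lift_fun:
  assumes "vector_space s1" "vector_space s"
    and "\<And>v w. Vector_Spaces.linear s1 s (\<lambda>x. h x v w)"
  shows "Vector_Spaces.linear s1 s (\<lambda>x. tensor_lift s (h x) p)"
proof -
  interpret S: vector_space s by fact
  show ?thesis
    by (rule linearI[OF assms(1,2)])
       (simp_all add: tensor_lift_def free_extend_def case_prod_unfold linear_addD[OF assms(3)]
          linear_scaleD[OF assms(3)] S.scale_right_distrib sum.distrib S.scale_sum_right mult.commute)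
qed

lemma linear_tens_left:
  assumes "smul V = s2" "Vector_Spaces.linear s1 s2 f"
  shows "Vector_Spaces.linear s1 free_scale (\<lambda>x. tens V W (f x) w)"
  by (rule linearI[OF linear_vector_spaces(1)[OF assms(2)] vector_space_free_scale])
     (use bilinear_tens[of V W] in \<open>simp_all add: bilinear_map_def assms(1)
        linear_addD[OF assms(2)] linear_scaleD[OF assms(2)]\<close>)

lemma linear_tens_right:
  assumes "smul W = s2" "Vector_Spaces.linear s1 s2 f"
  shows "Vector_Spaces.linear s1 free_scale (\<lambda>x. tens V W v (f x))"
  by (rule linearI[OF linear_vector_spaces(1)[OF assms(2)] vector_space_free_scale])
     (use bilinear_tens[of V W] in \<open>simp_all add: bilinear_map_def assms(1)
        linear_addD[OF assms(2)] linear_scaleD[OF assms(2)]\<close>)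

lemma linear_tensor_map:
  "Vector_Spaces.linear s1 free_scale f \<Longrightarrow>
   Vector_Spaces.linear s1 free_scale (\<lambda>x. tensor_map V W g h (f x))"
  unfolding tensor_map_def by (intro linear_lift_arg vector_space_free_scale)

lemma linear_assoc_right:
  "Vector_Spaces.linear s1 free_scale f \<Longrightarrow>
   Vector_Spaces.linear s1 free_scale (\<lambda>x. assoc_right U V W (f x))"
  unfolding assoc_right_def by (intro linear_lift_arg vector_space_free_scale)

lemma linear_assoc_left:
  "Vector_Spaces.linear s1 free_scale f \<Longrightarrow>
   Vector_Spaces.linear s1 free_scale (\<lambda>x. assoc_left U V W (f x))"
  unfolding assoc_left_def by (intro linear_lift_arg vector_space_free_scale)

lemma linear_tensor_middle:
  "Vector_Spaces.linear s1 free_scale f \<Longrightarrow>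
   Vector_Spaces.linear s1 free_scale (\<lambda>x. tensor_middle U V W X g (f x))"
  unfolding tensor_middle_def o_def by (intro linear_assoc_left linear_tensor_map linear_assoc_right)

text \<open>Closure rules by which \<open>intro\<close> proves linearity of nested expressions. The
  rules for \<open>tens\<close> occur twice: with \<open>smul_tensor\<close> for a factor that is
  itself a tensor product, scaled by \<open>free_scale\<close>, and with \<open>refl\<close> for a
  factor that keeps its own \<open>smul\<close>.\<close>

lemmas linear_intros = linear_tens_left[OF smul_tensor] linear_tens_right[OF smul_tensor]
  linear_tens_left[OF refl] linear_tens_right[OF refl] linear_tensor_map linear_assoc_right
  linear_assoc_left linear_tensor_middle linear_id' vector_space_free_scale

section \<open>Pure tensors and homogeneous parts of a tensor product\<close>

definition tens_span where
  "tens_span V W = module.span free_scale {tens V W v w | v w. True}"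

lemma tens_in_tens_span: "tens V W v w \<in> tens_span V W"
proof -
  interpret F: vector_space "free_scale" by (rule vector_space_free_scale)
  show ?thesis unfolding tens_span_def by (rule F.span_base) blast
qed

lemma subspace_tens_span: "module.subspace free_scale (tens_span V W)"
proof -
  interpret F: vector_space "free_scale" by (rule vector_space_free_scale)
  show ?thesis unfolding tens_span_def by (rule F.subspace_span)
qed

lemma subspace_tensor_part: "module.subspace free_scale (part (V \<otimes> W) m)"
proof -
  interpret F: vector_space "free_scale" by (rule vector_space_free_scale)
  show ?thesis unfolding tensor_def by simp
qed

lemma tensor_part_minimal:
  assumes "module.subspace free_scale S"
    and "\<And>k v w. k \<le> m \<Longrightarrow> v \<in> part V k \<Longrightarrow> w \<in> part W (m - k) \<Longrightarrow> tens V W v w \<in> S"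
  shows "part (V \<otimes> W) m \<subseteq> S"
proof -
  interpret F: vector_space "free_scale" by (rule vector_space_free_scale)
  show ?thesis unfolding tensor_def graded_space.simps
    by (rule F.span_minimal[OF _ assms(1)]) (use assms(2) in blast)
qed

lemma tens_in_part:
  assumes "v \<in> part V k" "w \<in> part W l" "k + l = m"
  shows "tens V W v w \<in> part (V \<otimes> W) m"
proof -
  interpret F: vector_space "free_scale" by (rule vector_space_free_scale)
  have "k \<le> m" "m - k = l" using assms(3) by auto
  with assms(1,2) show ?thesis unfolding tensor_def graded_space.simps
    by (intro F.span_base UN_I[of k]) auto
qed

lemma tensor_part_subset_tens_span: "part (V \<otimes> W) m \<subseteq> tens_span V W"
  by (rule tensor_part_minimal[OF subspace_tens_span tens_in_tens_span])

lemma linear_eq_on_span: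
  assumes "Vector_Spaces.linear s1 s2 f" "Vector_Spaces.linear s1 s2 g"
    and "x \<in> module.span s1 S" "\<And>y. y \<in> S \<Longrightarrow> f y = g y"
  shows "f x = g x"
  by (rule vector_space_pair.linear_eq_on[OF _ assms(1,2,3)])
     (use assms(4) linear_vector_spaces[OF assms(1)] in \<open>auto simp: vector_space_pair_def\<close>)

text \<open>The type of formal combinations is larger than the tensor product, and linear maps that
  agree on pure tensors agree only on \<open>tens_span\<close>. Hence the membership premise here,
  and the attention to ranges later.\<close>

lemma tens_span_eqI:
  assumes "Vector_Spaces.linear free_scale s f" "Vector_Spaces.linear free_scale s g"
    and "p \<in> tens_span V W" "\<And>v w. f (tens V W v w) = g (tens V W v w)"
  shows "f p = g p"
  by (rule linear_eq_on_span[OF assms(1,2) assms(3)[unfolded tens_span_def]]) (use assms(4) in auto)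

text \<open>The homogeneous variant, for identities known only up to some degree: it also supplies
  the degrees of the two factors.\<close>

lemma tensor_part_eqI:
  assumes "Vector_Spaces.linear free_scale s f" "Vector_Spaces.linear free_scale s g"
    and "p \<in> part (V \<otimes> W) m"
    and "\<And>k v w. k \<le> m \<Longrightarrow> v \<in> part V k \<Longrightarrow> w \<in> part W (m - k) \<Longrightarrow>
      f (tens V W v w) = g (tens V W v w)"
  shows "f p = g p"
proof -
  interpret F: vector_space "free_scale" by (rule vector_space_free_scale)
  interpret f: Vector_Spaces.linear free_scale s f by fact
  interpret g: Vector_Spaces.linear free_scale s g by fact
  have "F.subspace {p. f p = g p}"
    by (rule F.subspaceI) (auto simp: f.add g.add f.scale g.scale)
  from tensor_part_minimal[OF this] assms(3,4) show ?thesis by blast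
qed

lemma tensor_map_part:
  fixes V1 :: "('k::field, 'v1::ab_group_add) graded_space"
    and W1 :: "('k, 'w1::ab_group_add) graded_space"
    and V :: "('k, 'v::ab_group_add) graded_space" and W :: "('k, 'w::ab_group_add) graded_space"
  assumes f: "Vector_Spaces.linear (smul V) (smul V1) f" "\<And>k x. x \<in> part V k \<Longrightarrow> f x \<in> part V1 k"
    and g: "Vector_Spaces.linear (smul W) (smul W1) g" "\<And>k x. x \<in> part W k \<Longrightarrow> g x \<in> part W1 k"
    and p: "p \<in> part (V \<otimes> W) m"
  shows "tensor_map V1 W1 f g p \<in> part (V1 \<otimes> W1) m"
proof -
  interpret F: vector_space "free_scale :: 'k \<Rightarrow> ('v \<times> 'w \<Rightarrow>\<^sub>0 'k) \<Rightarrow> _"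
    by (rule vector_space_free_scale)
  interpret F1: vector_space "free_scale :: 'k \<Rightarrow> ('v1 \<times> 'w1 \<Rightarrow>\<^sub>0 'k) \<Rightarrow> _"
    by (rule vector_space_free_scale)
  interpret L: Vector_Spaces.linear free_scale free_scale "tensor_map V1 W1 f g"
    by (intro linear_intros)
  have "F.subspace {p. tensor_map V1 W1 f g p \<in> part (V1 \<otimes> W1) m}"
    by (rule F.subspaceI) (auto simp: L.add L.scale
        intro: F1.subspace_0 F1.subspace_add F1.subspace_scale subspace_tensor_part)
  then have "part (V \<otimes> W) m \<subseteq> {p. tensor_map V1 W1 f g p \<in> part (V1 \<otimes> W1) m}"
    by (rule tensor_part_minimal)
      (auto simp: tensor_map_tens[OF f(1) g(1)] intro!: tens_in_part f(2) g(2))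
  with p show ?thesis by blast
qed

section \<open>Multiplication and words of degree-one elements in a graded algebra\<close>

context graded_algebra
begin

lemma linear_mult_left:
  "Vector_Spaces.linear s (smul A) f \<Longrightarrow> Vector_Spaces.linear s (smul A) (\<lambda>x. a * f x)"
  by (rule linearI)
     (simp_all add: linear_vector_spaces vector_space linear_addD linear_scaleD distrib_left smul_mult_right)

lemma linear_mult_right:
  "Vector_Spaces.linear s (smul A) f \<Longrightarrow> Vector_Spaces.linear s (smul A) (\<lambda>x. f x * a)"
  by (rule linearI)
     (simp_all add: linear_vector_spaces vector_space linear_addD linear_scaleD distrib_right smul_mult_left)

lemma linear_mult_map: "Vector_Spaces.linear free_scale (smul A) (mult_map A)"
  unfolding mult_map_def by (rule linear_tensor_lift[OF vector_space])

lemma mult_map_part: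
  assumes "p \<in> part (A \<otimes> A) m" shows "mult_map A p \<in> part A m"
proof -
  interpret F: vector_space "free_scale :: 'k \<Rightarrow> ('a \<times> 'a \<Rightarrow>\<^sub>0 'k) \<Rightarrow> _"
    by (rule vector_space_free_scale)
  interpret A: vector_space "smul A" by (rule vector_space)
  interpret L: Vector_Spaces.linear free_scale "smul A" "mult_map A" by (rule linear_mult_map)
  have "F.subspace {p. mult_map A p \<in> part A m}"
    by (rule F.subspaceI) (auto simp: L.add L.scale
        intro: A.subspace_0 A.subspace_add A.subspace_scale subspace_part)
  from tensor_part_minimal[OF this, of m A A] assms show ?thesis
    using mult_part by (fastforce simp: mult_map_tens[OF graded_algebra_axioms])
qed

lemma foldr_mult_part:
  "xs \<in> lists (part A 1) \<Longrightarrow> foldr (*) xs 1 \<in> part A (length xs)"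
proof (induction xs)
  case (Cons x xs)
  then show ?case using mult_part[of x 1] by auto
qed (simp add: one_part)

lemma foldr_mult_append:
  fixes xs ys :: "'a list"
  shows "foldr (*) (xs @ ys) 1 = foldr (*) xs 1 * foldr (*) ys 1"
  by (induction xs) (simp_all add: mult_one_left mult.assoc)

text \<open>One-generation yields words of arbitrary length; grading sharpens this to words whose
  length is the degree of \<open>y\<close>.\<close>

lemma one_generated_part:
  assumes "one_generated A" and y: "y \<in> part A m"
  shows "y \<in> module.span (smul A) {foldr (*) xs 1 | xs. xs \<in> lists (part A 1) \<and> length xs = m}"
proof -
  interpret A: vector_space "smul A" by (rule vector_space)
  interpret F: vector_space "free_scale :: 'k \<Rightarrow> ('a list \<Rightarrow>\<^sub>0 'k) \<Rightarrow> _"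
    by (rule vector_space_free_scale)
  let ?f = "tensor_algebra_map A"
  let ?N = "tensor_algebra_relations (smul A) (part A 1)"
  interpret L: Vector_Spaces.linear free_scale "smul A" ?f
    unfolding tensor_algebra_map_def by (rule linear_free_extend[OF vector_space])
  have "F.subspace ?N" by (simp add: tensor_algebra_relations_def Let_def)
  note Q = quot_proj[OF this]
  interpret Q: Vector_Spaces.linear free_scale free_scale "quot_proj ?N" by (rule Q)
  have single: "?f (Poly_Mapping.single xs 1) = foldr (*) xs 1" for xs
    by (simp add: tensor_algebra_map_def free_extend_single[OF vector_space])
  have sub: "F.subspace {p. ?f p = 0}"
    by (rule F.subspaceI) (auto simp: L.add L.scale)
  \<comment> \<open>Evaluation of words kills the multilinearity relations, so it does not see the
    choice of coset representatives made by \<open>quot_proj\<close>.\<close>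
  have "?N \<subseteq> {p. ?f p = 0}"
    unfolding tensor_algebra_relations_def Let_def
    by (rule F.span_minimal[OF _ sub])
       (auto simp: L.diff L.scale single foldr_mult_append distrib_left distrib_right
          simp flip: smul_mult_left smul_mult_right simp del: foldr_append)
  then have kill: "?f p = 0" if "p \<in> ?N" for p using that by blast
  have quot: "?f (quot_proj ?N p) = ?f p" for p
  proof -
    have "p - quot_proj ?N p \<in> ?N"
      using Q(2,3) by (simp add: Q.diff flip: Q(3) del: One_nat_def)
    from kill[OF this] show ?thesis by (simp add: L.diff)
  qed
  have "y \<in> ?f ` tensor_algebra (smul A) (part A 1)"
    using assms by (simp add: one_generated_def)
  then obtain p where p: "Poly_Mapping.keys p \<subseteq> lists (part A 1)" "y = ?f p"
    by (auto simp: tensor_algebra_def quot simp del: One_nat_def)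
  let ?c = "component A m"
  interpret C: Vector_Spaces.linear "smul A" "smul A" ?c
    by (rule linearI) (simp_all add: vector_space component_add component_smul)
  \<comment> \<open>Project the expansion of \<open>y\<close> to degree \<open>m\<close>. A word is
    homogeneous of degree its length, so words of any other length contribute
    \<open>0\<close>.\<close>
  have "y = ?c y" using component_part[OF y] by simp
  also have "\<dots> = (\<Sum>xs\<in>Poly_Mapping.keys p. smul A (Poly_Mapping.lookup p xs) (?c (foldr (*) xs 1)))"
    by (simp add: p(2) tensor_algebra_map_def free_extend_def C.sum C.scale)
  also have "\<dots> \<in> A.span {foldr (*) xs 1 | xs. xs \<in> lists (part A 1) \<and> length xs = m}"
  proof (intro A.span_sum A.span_scale)
    fix xs assume "xs \<in> Poly_Mapping.keys p"
    then have "xs \<in> lists (part A 1)" using p by blast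
    then show "?c (foldr (*) xs 1) \<in> A.span {foldr (*) xs 1 | xs. xs \<in> lists (part A 1) \<and> length xs = m}"
      using component_part[OF foldr_mult_part, of xs m] by (auto intro: A.span_base A.span_zero)
  qed
  finally show ?thesis .
qed

text \<open>Split off the last or the first letter of each word. The induction for the right rule
  uses the first form, the one for the left rule the second.\<close>

lemma one_generated_part_Suc:
  assumes "one_generated A" and "y \<in> part A (Suc m)"
  shows "y \<in> module.span (smul A) {a * x | a x. a \<in> part A m \<and> x \<in> part A 1}"
    and "y \<in> module.span (smul A) {x * a | a x. a \<in> part A m \<and> x \<in> part A 1}"
proof -
  interpret A: vector_space "smul A" by (rule vector_space)
  let ?W = "{foldr (*) xs 1 | xs. xs \<in> lists (part A 1) \<and> length xs = Suc m}"
  have "?W \<subseteq> {a * x | a x. a \<in> part A m \<and> x \<in> part A 1}"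
  proof
    fix z assume "z \<in> ?W"
    then obtain xs where "xs \<in> lists (part A 1)" "length xs = Suc m" "z = foldr (*) xs 1" by blast
    moreover from this obtain ys x where "xs = ys @ [x]" by (metis length_Suc_conv_rev)
    ultimately show "z \<in> {a * x | a x. a \<in> part A m \<and> x \<in> part A 1}"
      using foldr_mult_part[of ys] by (auto simp: foldr_mult_append mult_one_right simp del: foldr_append)
  qed
  with one_generated_part[OF assms] show "y \<in> A.span {a * x | a x. a \<in> part A m \<and> x \<in> part A 1}"
    using A.span_mono by blast
  have "?W \<subseteq> {x * a | a x. a \<in> part A m \<and> x \<in> part A 1}"
    using foldr_mult_part by (fastforce simp: length_Suc_conv)
  with one_generated_part[OF assms] show "y \<in> A.span {x * a | a x. a \<in> part A m \<and> x \<in> part A 1}"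
    using A.span_mono by blast
qed

end

section \<open>Exchange maps\<close>

text \<open>The actions making \<open>A \<otimes> B\<close> a left \<open>A\<close>-module and a
  right \<open>B\<close>-module. They absorb an associator followed by a multiplication, see
  \<open>multiply_left\<close> and \<open>multiply_right\<close>.\<close>

definition act_left where
  "act_left A B a = tensor_lift free_scale (\<lambda>x y. tens A B (a * x) y)"

definition act_right where
  "act_right A B b = tensor_lift free_scale (\<lambda>x y. tens A B x (y * b))"

text \<open>
  In tensor notation \<open>pass_right\<close> sends \<open>p\<close> to \<open>(\<mu> \<otimes> 1)(1 \<otimes> \<tau>)(p \<otimes> a)\<close>, \<open>pass_left\<close> sends \<open>p\<close> to
  \<open>(1 \<otimes> \<mu>)(\<tau> \<otimes> 1)(b \<otimes> p)\<close> and \<open>pass_both\<close> is \<open>(\<mu> \<otimes> \<mu>)(1 \<otimes> \<tau> \<otimes> 1)(p \<otimes> q)\<close>.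
\<close>

definition pass_right where
  "pass_right A B \<tau> a = tensor_lift free_scale (\<lambda>x y. act_left A B x (\<tau> (tens B A y a)))"

definition pass_left where
  "pass_left A B \<tau> b = tensor_lift free_scale (\<lambda>x y. act_right A B y (\<tau> (tens B A b x)))"

definition pass_both where
  "pass_both A B \<tau> p q = tensor_lift free_scale
     (\<lambda>x y. tensor_lift free_scale
       (\<lambda>x' y'. act_left A B x (act_right A B y' (\<tau> (tens B A y x')))) q) p"

text \<open>The right-hand side of the twisting axiom on
  \<open>b \<otimes> b' \<otimes> a \<otimes> a'\<close>: \<open>b'\<close> passes \<open>a\<close>,
  giving terms \<open>x \<otimes> y\<close>; then \<open>b\<close> passes \<open>x\<close> and
  \<open>y\<close> passes \<open>a'\<close>; \<open>pass_both\<close> performs the last exchange and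
  multiplies.\<close>

definition twisted_product where
  "twisted_product A B \<tau> b b' a a' =
     tensor_lift free_scale (\<lambda>x y. pass_both A B \<tau> (\<tau> (tens B A b x)) (\<tau> (tens B A y a')))
       (\<tau> (tens B A b' a))"

text \<open>A map given only up to some degree cannot be tensored with identities, so
  \<open>\<tau>\<close> is total and linear. Confining its values to \<open>tens_span A B\<close>
  allows any linear identity about a value to be tested on pure tensors.\<close>

locale exchange_map = A: graded_algebra A + B: graded_algebra B
  for A :: "('k::field, 'a::{ring, one}) graded_space"
    and B :: "('k, 'b::{ring, one}) graded_space" +
  fixes \<tau> :: "('b \<times> 'a \<Rightarrow>\<^sub>0 'k) \<Rightarrow> ('a \<times> 'b \<Rightarrow>\<^sub>0 'k)"
  assumes linear: "Vector_Spaces.linear free_scale free_scale \<tau>"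
    and range: "\<tau> p \<in> tens_span A B"
begin

abbreviation "lact \<equiv> act_left A B"
abbreviation "ract \<equiv> act_right A B"
abbreviation "pr \<equiv> pass_right A B \<tau>"
abbreviation "pl \<equiv> pass_left A B \<tau>"

lemma linear_\<tau>:
  "Vector_Spaces.linear s free_scale f \<Longrightarrow> Vector_Spaces.linear s free_scale (\<lambda>x. \<tau> (f x))"
  by (rule linear_comp[OF linear])

lemma linear_lact:
  "Vector_Spaces.linear s free_scale f \<Longrightarrow> Vector_Spaces.linear s free_scale (\<lambda>x. lact a (f x))"
  unfolding act_left_def by (intro linear_lift_arg vector_space_free_scale)

lemma linear_ract:
  "Vector_Spaces.linear s free_scale f \<Longrightarrow> Vector_Spaces.linear s free_scale (\<lambda>x. ract b (f x))"
  unfolding act_right_def by (intro linear_lift_arg vector_space_free_scale)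

lemma linear_lact_fun:
  "Vector_Spaces.linear s (smul A) f \<Longrightarrow> Vector_Spaces.linear s free_scale (\<lambda>x. lact (f x) p)"
  unfolding act_left_def
  by (intro linear_lift_fun linear_tens_left[OF refl] A.linear_mult_right vector_space_free_scale)
    (rule linear_vector_spaces)

lemma linear_ract_fun:
  "Vector_Spaces.linear s (smul B) f \<Longrightarrow> Vector_Spaces.linear s free_scale (\<lambda>x. ract (f x) p)"
  unfolding act_right_def
  by (intro linear_lift_fun linear_tens_right[OF refl] B.linear_mult_left vector_space_free_scale)
    (rule linear_vector_spaces)

lemma linear_pr:
  "Vector_Spaces.linear s free_scale f \<Longrightarrow> Vector_Spaces.linear s free_scale (\<lambda>x. pr a (f x))"
  unfolding pass_right_def by (intro linear_lift_arg vector_space_free_scale)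

lemma linear_pl:
  "Vector_Spaces.linear s free_scale f \<Longrightarrow> Vector_Spaces.linear s free_scale (\<lambda>x. pl a (f x))"
  unfolding pass_left_def by (intro linear_lift_arg vector_space_free_scale)

lemma linear_pr_fun:
  "Vector_Spaces.linear s (smul A) f \<Longrightarrow> Vector_Spaces.linear s free_scale (\<lambda>x. pr (f x) p)"
  unfolding pass_right_def
  by (intro linear_lift_fun linear_lact linear_\<tau> linear_tens_right[OF refl] vector_space_free_scale)
    (rule linear_vector_spaces)

lemma linear_pl_fun:
  "Vector_Spaces.linear s (smul B) f \<Longrightarrow> Vector_Spaces.linear s free_scale (\<lambda>x. pl (f x) p)"
  unfolding pass_left_def
  by (intro linear_lift_fun linear_ract linear_\<tau> linear_tens_left[OF refl] vector_space_free_scale)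
    (rule linear_vector_spaces)

lemma linear_both_left:
  "Vector_Spaces.linear s free_scale f \<Longrightarrow>
   Vector_Spaces.linear s free_scale (\<lambda>x. pass_both A B \<tau> (f x) q)"
  unfolding pass_both_def by (intro linear_lift_arg vector_space_free_scale)

lemma linear_both_right:
  "Vector_Spaces.linear s free_scale f \<Longrightarrow>
   Vector_Spaces.linear s free_scale (\<lambda>x. pass_both A B \<tau> p (f x))"
  unfolding pass_both_def
  by (intro linear_lift_fun linear_lift_arg vector_space_free_scale) (rule linear_vector_spaces)

lemmas linear_rules = linear_intros linear_\<tau> linear_lact linear_ract linear_lact_fun linear_ract_fun
  linear_pr linear_pl linear_pr_fun linear_pl_fun linear_both_left linear_both_right
  A.linear_mult_left A.linear_mult_right B.linear_mult_left B.linear_mult_right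
  A.vector_space B.vector_space
  A.linear_mult_map B.linear_mult_map

lemma lact_tens: "lact a (tens A B x y) = tens A B (a * x) y"
  unfolding act_left_def
  by (intro tensor_lift_tens bilinear_mapI linear_rules)

lemma ract_tens: "ract b (tens A B x y) = tens A B x (y * b)"
  unfolding act_right_def
  by (intro tensor_lift_tens bilinear_mapI linear_rules)

lemma pr_tens: "pr a (tens A B x y) = lact x (\<tau> (tens B A y a))"
  unfolding pass_right_def
  by (intro tensor_lift_tens bilinear_mapI linear_rules)

lemma pl_tens: "pl b (tens A B x y) = ract y (\<tau> (tens B A b x))"
  unfolding pass_left_def
  by (intro tensor_lift_tens bilinear_mapI linear_rules)

lemma both_tens:
  "pass_both A B \<tau> (tens A B x y) (tens A B x' y') = lact x (ract y' (\<tau> (tens B A y x')))"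
proof -
  have "pass_both A B \<tau> (tens A B x y) q = tensor_lift free_scale
       (\<lambda>x' y'. act_left A B x (act_right A B y' (\<tau> (tens B A y x')))) q" for q
    unfolding pass_both_def
    by (intro tensor_lift_tens bilinear_mapI linear_lift_fun linear_rules)
  moreover have "tensor_lift free_scale
       (\<lambda>x' y'. act_left A B x (act_right A B y' (\<tau> (tens B A y x')))) (tens A B x' y') =
       lact x (ract y' (\<tau> (tens B A y x')))"
    by (intro tensor_lift_tens bilinear_mapI linear_rules)
  ultimately show ?thesis by simp
qed

section \<open>The composites of the twisting conditions, evaluated on pure tensors\<close>

lemma tensor_map_id_tens:
  assumes "Vector_Spaces.linear (smul V) (smul V1) f"
  shows "vector_space (smul W) \<Longrightarrow> tensor_map V1 W f id (tens V W v w) = tens V1 W (f v) w"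
    "vector_space (smul W) \<Longrightarrow> tensor_map W V1 id f (tens W V w v) = tens W V1 w (f v)"
  by (simp_all add: tensor_map_tens assms vector_space.linear_id)

lemma \<tau>_map_tens:
  "vector_space (smul W) \<Longrightarrow>
     tensor_map (A \<otimes> B) W \<tau> id (tens (B \<otimes> A) W p w) = tens (A \<otimes> B) W (\<tau> p) w"
  "vector_space (smul W) \<Longrightarrow>
     tensor_map W (A \<otimes> B) id \<tau> (tens W (B \<otimes> A) w p) = tens W (A \<otimes> B) w (\<tau> p)"
  using linear by (auto intro!: tensor_map_id_tens)

lemma mult_A_map_tens:
  "tensor_map A B (mult_map A) id (tens (A \<otimes> A) B (tens A A a a') b) = tens A B (a * a') b"
  "tensor_map B A id (mult_map A) (tens B (A \<otimes> A) b (tens A A a a')) = tens B A b (a * a')"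
  by (subst tensor_map_id_tens; simp add: A.linear_mult_map B.vector_space mult_map_tens A.graded_algebra_axioms)+

lemma mult_B_map_tens:
  "tensor_map B A (mult_map B) id (tens (B \<otimes> B) A (tens B B b b') a) = tens B A (b * b') a"
  "tensor_map A B id (mult_map B) (tens A (B \<otimes> B) a (tens B B b b')) = tens A B a (b * b')"
  by (subst tensor_map_id_tens; simp add: B.linear_mult_map A.vector_space mult_map_tens B.graded_algebra_axioms)+

lemma multiply_left:
  assumes "q \<in> tens_span A B"
  shows "tensor_map A B (mult_map A) id (assoc_left A A B (tens A (A \<otimes> B) a q)) = lact a q"
  by (rule tens_span_eqI[where s = free_scale, OF _ _ assms])
     (simp_all only: assoc_left_tens mult_A_map_tens lact_tens, (intro linear_rules)+)

lemma multiply_right: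
  assumes "q \<in> tens_span A B"
  shows "tensor_map A B id (mult_map B) (assoc_right A B B (tens (A \<otimes> B) B q b)) = ract b q"
  by (rule tens_span_eqI[where s = free_scale, OF _ _ assms])
     (simp_all only: assoc_right_tens mult_B_map_tens ract_tens, (intro linear_rules)+)

text \<open>This is the right-hand side of hypothesis (2), and \<open>left_composite\<close> that of
  (3). The first exchange leaves a general element of \<open>tens_span\<close>; all remaining maps
  are linear in it, so a pure tensor may take its place.\<close>

lemma right_composite:
  "(tensor_map A B (mult_map A) id \<circ> assoc_left A A B \<circ>
       tensor_map A (A \<otimes> B) id \<tau> \<circ> assoc_right A B A \<circ>
       tensor_map (A \<otimes> B) A \<tau> id \<circ> assoc_left B A A) (tens B (A \<otimes> A) b (tens A A a a')) =
   pr a' (\<tau> (tens B A b a))"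
proof -
  have "tensor_map A B (mult_map A) id (assoc_left A A B (tensor_map A (A \<otimes> B) id \<tau>
      (assoc_right A B A (tens (A \<otimes> B) A p a')))) = pr a' p" if "p \<in> tens_span A B" for p
    by (rule tens_span_eqI[where s = free_scale, OF _ _ that])
       (simp_all only: assoc_right_tens \<tau>_map_tens A.vector_space multiply_left range pr_tens,
         (intro linear_rules)+)
  then show ?thesis by (simp add: assoc_left_tens \<tau>_map_tens A.vector_space range)
qed

lemma left_composite:
  "(tensor_map A B id (mult_map B) \<circ> assoc_right A B B \<circ>
       tensor_map (A \<otimes> B) B \<tau> id \<circ> assoc_left B A B \<circ>
       tensor_map B (A \<otimes> B) id \<tau> \<circ> assoc_right B B A) (tens (B \<otimes> B) A (tens B B b b') a) =
   pl b (\<tau> (tens B A b' a))"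
proof -
  have "tensor_map A B id (mult_map B) (assoc_right A B B (tensor_map (A \<otimes> B) B \<tau> id
      (assoc_left B A B (tens B (A \<otimes> B) b p)))) = pl b p" if "p \<in> tens_span A B" for p
    by (rule tens_span_eqI[where s = free_scale, OF _ _ that])
       (simp_all only: assoc_left_tens \<tau>_map_tens B.vector_space multiply_right range pl_tens,
         (intro linear_rules)+)
  then show ?thesis by (simp add: assoc_right_tens \<tau>_map_tens B.vector_space range)
qed

lemma middle_composite:
  "tensor_middle B B A A \<tau> (tens (B \<otimes> B) (A \<otimes> A) (tens B B b b') (tens A A a a')) =
   assoc_left B A (B \<otimes> A) (tens B (A \<otimes> B \<otimes> A) b
     (assoc_right A B A (tens (A \<otimes> B) A (\<tau> (tens B A b' a)) a')))"
proof -
  let ?g = "assoc_right A B A \<circ> tensor_map (A \<otimes> B) A \<tau> id \<circ> assoc_left B A A"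
  have "Vector_Spaces.linear (smul (B \<otimes> A \<otimes> A)) (smul (A \<otimes> B \<otimes> A)) ?g"
    unfolding o_def smul_tensor by (intro linear_rules)
  from tensor_map_id_tens(2)[OF this B.vector_space]
  show ?thesis
    by (simp add: tensor_middle_def assoc_right_tens assoc_left_tens \<tau>_map_tens A.vector_space)
qed

lemma middle_composite':
  "tensor_middle A B A B \<tau> (tens (A \<otimes> B) (A \<otimes> B) (tens A B a b) (tens A B a' b')) =
   assoc_left A A (B \<otimes> B) (tens A (A \<otimes> B \<otimes> B) a
     (assoc_right A B B (tens (A \<otimes> B) B (\<tau> (tens B A b a')) b')))"
proof -
  let ?g = "assoc_right A B B \<circ> tensor_map (A \<otimes> B) B \<tau> id \<circ> assoc_left B A B"
  have "Vector_Spaces.linear (smul (B \<otimes> A \<otimes> B)) (smul (A \<otimes> B \<otimes> B)) ?g"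
    unfolding o_def smul_tensor by (intro linear_rules)
  from tensor_map_id_tens(2)[OF this A.vector_space]
  show ?thesis
    by (simp add: tensor_middle_def assoc_right_tens assoc_left_tens \<tau>_map_tens B.vector_space)
qed

lemma multiply_both:
  assumes "q \<in> tens_span A B"
  shows "tensor_map A B (mult_map A) (mult_map B) (assoc_left A A (B \<otimes> B) (tens A (A \<otimes> B \<otimes> B) a
     (assoc_right A B B (tens (A \<otimes> B) B q b)))) = lact a (ract b q)"
proof (rule tens_span_eqI[where s = free_scale, OF _ _ assms])
  show "tensor_map A B (mult_map A) (mult_map B) (assoc_left A A (B \<otimes> B) (tens A (A \<otimes> B \<otimes> B) a
     (assoc_right A B B (tens (A \<otimes> B) B (tens A B x y) b)))) = lact a (ract b (tens A B x y))" for x y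
    using tensor_map_tens[of "A \<otimes> A" A "mult_map A" "B \<otimes> B" B "mult_map B"]
    by (simp add: assoc_right_tens assoc_left_tens A.linear_mult_map B.linear_mult_map
      mult_map_tens A.graded_algebra_axioms B.graded_algebra_axioms lact_tens ract_tens)
qed (intro linear_rules)+

lemma twisted_product_lift:
  "tensor_lift free_scale (\<lambda>x y. pass_both A B \<tau> (\<tau> (tens B A b x)) (\<tau> (tens B A y a)))
     (tens A B x y) = pass_both A B \<tau> (\<tau> (tens B A b x)) (\<tau> (tens B A y a))"
  by (intro tensor_lift_tens bilinear_mapI linear_rules)

text \<open>Outputs of \<open>\<tau>\<close> are not pure tensors, so they are replaced by pure ones
  one at a time, by linearity. Facts \<open>1\<close> and \<open>2\<close> identify the two
  outermost maps with \<open>pass_both\<close>, for a pure and then a general left factor; the last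
  claim does the same for the innermost output \<open>p\<close>.\<close>

lemma twisting_composite:
  "(tensor_map A B (mult_map A) (mult_map B) \<circ> tensor_middle A B A B \<tau> \<circ>
     tensor_map (A \<otimes> B) (A \<otimes> B) \<tau> \<tau> \<circ> tensor_middle B B A A \<tau>)
     (tens (B \<otimes> B) (A \<otimes> A) (tens B B b b') (tens A A a a')) =
   twisted_product A B \<tau> b b' a a'"
proof -
  let ?F = "\<lambda>z. tensor_map A B (mult_map A) (mult_map B) (tensor_middle A B A B \<tau> z)"
  have 1: "?F (tens (A \<otimes> B) (A \<otimes> B) (tens A B x y) r) = pass_both A B \<tau> (tens A B x y) r"
    if "r \<in> tens_span A B" for r x y
    by (rule tens_span_eqI[where s = free_scale, OF _ _ that])
       (simp_all only: middle_composite' multiply_both range both_tens, (intro linear_rules)+)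
  have 2: "?F (tens (A \<otimes> B) (A \<otimes> B) q r) = pass_both A B \<tau> q r"
    if "q \<in> tens_span A B" "r \<in> tens_span A B" for q r
    by (rule tens_span_eqI[where s = free_scale, OF _ _ that(1)]) (simp_all only: 1[OF that(2)], (intro linear_rules)+)
  have \<tau>\<tau>: "tensor_map (A \<otimes> B) (A \<otimes> B) \<tau> \<tau> (tens (B \<otimes> A) (B \<otimes> A) q r) =
      tens (A \<otimes> B) (A \<otimes> B) (\<tau> q) (\<tau> r)" for q r
    by (rule tensor_map_tens) (simp_all add: linear)
  have "?F (tensor_map (A \<otimes> B) (A \<otimes> B) \<tau> \<tau> (assoc_left B A (B \<otimes> A) (tens B (A \<otimes> B \<otimes> A) b
     (assoc_right A B A (tens (A \<otimes> B) A p a'))))) =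
   tensor_lift free_scale (\<lambda>x y. pass_both A B \<tau> (\<tau> (tens B A b x)) (\<tau> (tens B A y a'))) p"
    if "p \<in> tens_span A B" for p
    by (rule tens_span_eqI[where s = free_scale, OF _ _ that])
       (simp_all only: assoc_right_tens assoc_left_tens \<tau>\<tau> 2 range twisted_product_lift,
        (intro linear_rules linear_lift_arg)+)
  then show ?thesis by (simp add: middle_composite range twisted_product_def)
qed

end

section \<open>The one-sided multiplication rules\<close>

text \<open>Rule \<open>R\<close> of the overview in fixed degrees. The degrees are kept apart
  because \<open>R\<close> is first known for \<open>l' = 1\<close> and the induction runs over
  \<open>l'\<close>; for \<open>left_rule\<close> the same holds with \<open>k\<close>.\<close>

definition right_rule where
  "right_rule A B \<tau> k l l' \<longleftrightarrow> (\<forall>b\<in>part B k. \<forall>a\<in>part A l. \<forall>a'\<in>part A l'.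
     \<tau> (tens B A b (a * a')) = pass_right A B \<tau> a' (\<tau> (tens B A b a)))"

definition left_rule where
  "left_rule A B \<tau> k k' l \<longleftrightarrow> (\<forall>b\<in>part B k. \<forall>b'\<in>part B k'. \<forall>a\<in>part A l.
     \<tau> (tens B A (b * b') a) = pass_left A B \<tau> b (\<tau> (tens B A b' a)))"

context exchange_map
begin

lemma lact_mult: "q \<in> tens_span A B \<Longrightarrow> lact (a * a') q = lact a (lact a' q)"
  by (erule tens_span_eqI[where s = free_scale, rotated 2])
     (simp_all only: lact_tens mult.assoc, (intro linear_rules)+)

lemma ract_mult: "q \<in> tens_span A B \<Longrightarrow> ract (b * b') q = ract b' (ract b q)"
  by (erule tens_span_eqI[where s = free_scale, rotated 2])
     (simp_all only: ract_tens mult.assoc, (intro linear_rules)+)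

lemma lact_one: "q \<in> tens_span A B \<Longrightarrow> lact 1 q = q"
  by (erule tens_span_eqI[where s = free_scale, rotated 2])
     (simp_all only: lact_tens A.mult_one_left, (intro linear_rules)+)

lemma ract_one: "q \<in> tens_span A B \<Longrightarrow> ract 1 q = q"
  by (erule tens_span_eqI[where s = free_scale, rotated 2])
     (simp_all only: ract_tens B.mult_one_right, (intro linear_rules)+)

text \<open>Stated separately so that membership in \<open>tens_span\<close> is asked of
  \<open>q\<close> and not of \<open>ract b q\<close>.\<close>

lemma lact_one_ract: "q \<in> tens_span A B \<Longrightarrow> lact 1 (ract b q) = ract b q"
  by (erule tens_span_eqI[where s = free_scale, rotated 2])
     (simp_all only: lact_tens ract_tens A.mult_one_left, (intro linear_rules)+)

text \<open>\<open>pr\<close> moves only the \<open>B\<close>-factor past \<open>a\<close> and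
  multiplies the outcome in from the right of the \<open>A\<close>-factor, so it commutes with left
  multiplication.\<close>

lemma pr_lact: "q \<in> tens_span A B \<Longrightarrow> pr a (lact a' q) = lact a' (pr a q)"
  by (erule tens_span_eqI[where s = free_scale, rotated 2])
     (simp_all only: lact_tens pr_tens lact_mult range, (intro linear_rules)+)

lemma pl_ract: "q \<in> tens_span A B \<Longrightarrow> pl b (ract b' q) = ract b' (pl b q)"
  by (erule tens_span_eqI[where s = free_scale, rotated 2])
     (simp_all only: ract_tens pl_tens ract_mult range, (intro linear_rules)+)

lemma both_tens_left: "r \<in> tens_span A B \<Longrightarrow> pass_both A B \<tau> (tens A B x y) r = lact x (pl y r)"
  by (erule tens_span_eqI[where s = free_scale, rotated 2])
     (simp_all only: both_tens pl_tens, (intro linear_rules)+)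

lemma both_one_left: "r \<in> tens_span A B \<Longrightarrow> pass_both A B \<tau> (tens A B 1 y) r = pl y r"
  by (erule tens_span_eqI[where s = free_scale, rotated 2])
     (simp_all only: both_tens pl_tens lact_one_ract range, (intro linear_rules)+)

lemma both_one_right: "q \<in> tens_span A B \<Longrightarrow> pass_both A B \<tau> q (tens A B x 1) = pr x q"
  by (erule tens_span_eqI[where s = free_scale, rotated 2])
     (simp_all only: both_tens pr_tens ract_one range, (intro linear_rules)+)

end

section \<open>Exchange maps that are graded and unital up to degree \<open>m\<close>\<close>

locale unital_exchange_map = exchange_map +
  fixes m :: nat
  assumes graded: "\<And>j x. j \<le> m \<Longrightarrow> x \<in> part (B \<otimes> A) j \<Longrightarrow> \<tau> x \<in> part (A \<otimes> B) j"
    and unital_left: "\<And>k a. k \<le> m \<Longrightarrow> a \<in> part A k \<Longrightarrow> \<tau> (tens B A 1 a) = tens A B a 1"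
    and unital_right: "\<And>k b. k \<le> m \<Longrightarrow> b \<in> part B k \<Longrightarrow> \<tau> (tens B A b 1) = tens A B 1 b"
begin

lemma \<tau>_tens_part:
  "b \<in> part B k \<Longrightarrow> a \<in> part A l \<Longrightarrow> k + l \<le> m \<Longrightarrow> \<tau> (tens B A b a) \<in> part (A \<otimes> B) (k + l)"
  by (rule graded) (auto intro: tens_in_part)

text \<open>Take \<open>b' = 1\<close>. Then \<open>1\<close> passes \<open>a\<close> and
  \<open>a'\<close> trivially, and the twisted product collapses to \<open>pass_both\<close> of
  \<open>\<tau> (tens B A b a)\<close> with \<open>tens A B a' 1\<close>, which is
  \<open>pr a'\<close>.\<close>

lemma right_rule_of_twisted_product:
  assumes "\<And>b b' a a'. b \<in> part B k \<Longrightarrow> b' \<in> part B 0 \<Longrightarrow> a \<in> part A l \<Longrightarrow> a' \<in> part A l' \<Longrightarrow>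
      \<tau> (tens B A (b * b') (a * a')) = twisted_product A B \<tau> b b' a a'"
    and "l \<le> m" "l' \<le> m"
  shows "right_rule A B \<tau> k l l'"
  unfolding right_rule_def
proof (intro ballI)
  fix b a a' assume H: "b \<in> part B k" "a \<in> part A l" "a' \<in> part A l'"
  show "\<tau> (tens B A b (a * a')) = pr a' (\<tau> (tens B A b a))"
    using assms(1)[OF H(1) B.one_part H(2,3)]
    by (simp add: twisted_product_def B.mult_one_right unital_left[OF assms(2) H(2)]
        unital_left[OF assms(3) H(3)] twisted_product_lift both_one_right range)
qed

text \<open>Here the inner \<open>A\<close>-factor is \<open>1\<close>: both \<open>b\<close> and
  \<open>b'\<close> pass it trivially, leaving \<open>pass_both\<close> with left argument
  \<open>tens A B 1 b\<close>, which is \<open>pl b\<close>.\<close>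

lemma left_rule_of_twisted_product:
  assumes "\<And>b b' a a'. b \<in> part B k \<Longrightarrow> b' \<in> part B k' \<Longrightarrow> a \<in> part A 0 \<Longrightarrow> a' \<in> part A l \<Longrightarrow>
      \<tau> (tens B A (b * b') (a * a')) = twisted_product A B \<tau> b b' a a'"
    and "k \<le> m" "k' \<le> m"
  shows "left_rule A B \<tau> k k' l"
  unfolding left_rule_def
proof (intro ballI)
  fix b b' a assume H: "b \<in> part B k" "b' \<in> part B k'" "a \<in> part A l"
  show "\<tau> (tens B A (b * b') a) = pl b (\<tau> (tens B A b' a))"
    using assms(1)[OF H(1,2) A.one_part H(3)]
    by (simp add: twisted_product_def A.mult_one_left unital_right[OF assms(2) H(1)]
        unital_right[OF assms(3) H(2)] twisted_product_lift both_one_left range)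
qed

lemma pr_one:
  assumes "p \<in> part (A \<otimes> B) d" "d \<le> m" shows "pr 1 p = p"
proof (rule tensor_part_eqI[where s = free_scale, OF _ _ assms(1)])
  fix k x y assume "k \<le> d" "x \<in> part A k" "y \<in> part B (d - k)"
  moreover have "d - k \<le> m" using assms by simp
  ultimately show "pr 1 (tens A B x y) = tens A B x y"
    by (simp add: pr_tens unital_right lact_tens A.mult_one_right)
qed (intro linear_rules)+

lemma pl_one:
  assumes "p \<in> part (A \<otimes> B) d" "d \<le> m" shows "pl 1 p = p"
proof (rule tensor_part_eqI[where s = free_scale, OF _ _ assms(1)])
  fix k x y assume "k \<le> d" "x \<in> part A k" "y \<in> part B (d - k)"
  moreover have "k \<le> m" using assms \<open>k \<le> d\<close> by simp
  ultimately show "pl 1 (tens A B x y) = tens A B x y"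
    by (simp add: pl_tens unital_left ract_tens B.mult_one_left)
qed (intro linear_rules)+

lemma right_rule_degree_one:
  assumes "connected_graded_algebra A" "one_generated A"
    and one: "\<And>k l. k + l + 1 \<le> m \<Longrightarrow> right_rule A B \<tau> k l 1"
  shows "k + l + l' \<le> m \<Longrightarrow> right_rule A B \<tau> k l l'"
proof (induction l' arbitrary: k l)
  case 0
  show ?case unfolding right_rule_def
  proof (intro ballI)
    fix b a a' assume H: "b \<in> part B k" "a \<in> part A l" "a' \<in> part A 0"
    \<comment> \<open>By connectedness \<open>a'\<close> is a scalar multiple of \<open>1\<close>.
      The scalar comes out of both sides, and the case \<open>a' = 1\<close> is
      \<open>pr_one\<close>.\<close>
    then obtain c where c: "a' = smul A c 1"
      using connected_graded_algebra.connected[OF assms(1)] by auto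
    have "\<tau> (tens B A b (a * smul A c 1)) = free_scale c (\<tau> (tens B A b (a * 1)))"
      by (rule linear_scaleD[where f = "\<lambda>x. \<tau> (tens B A b (a * x))"]) (intro linear_rules)
    also have "\<dots> = free_scale c (pr 1 (\<tau> (tens B A b a)))"
      using 0 H by (simp add: A.mult_one_right pr_one[OF \<tau>_tens_part])
    also have "\<dots> = pr (smul A c 1) (\<tau> (tens B A b a))"
      by (rule linear_scaleD[where f = "\<lambda>x. pr x (\<tau> (tens B A b a))", symmetric]) (intro linear_rules)
    finally show "\<tau> (tens B A b (a * a')) = pr a' (\<tau> (tens B A b a))" using c by simp
  qed
next
  case (Suc l')
  show ?case unfolding right_rule_def
  proof (intro ballI)
    fix b a a' assume H: "b \<in> part B k" "a \<in> part A l" "a' \<in> part A (Suc l')"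
    \<comment> \<open>Both sides are linear in \<open>a'\<close>, so \<open>a'\<close> may be taken
      as a product \<open>c * x\<close> with \<open>x\<close> of degree one.\<close>
    show "\<tau> (tens B A b (a * a')) = pr a' (\<tau> (tens B A b a))"
    proof (rule linear_eq_on_span[where ?s2.0 = free_scale, OF _ _ A.one_generated_part_Suc(1)[OF assms(2) H(3)]])
      fix z assume "z \<in> {a * x |a x. a \<in> part A l' \<and> x \<in> part A 1}"
      then obtain c x where z: "z = c * x" "c \<in> part A l'" "x \<in> part A 1" by blast
      \<comment> \<open>Passing \<open>c * x\<close> in two stages: on \<open>u \<otimes> v\<close>
        this is the degree-one rule for \<open>v\<close>, \<open>c\<close>, \<open>x\<close>, and
        \<open>pr_lact\<close> carries the factor \<open>u\<close> along. The total degree stays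
        within \<open>m\<close> because \<open>v\<close> has degree at most
        \<open>k + l\<close>.\<close>
      have pr: "pr (c * x) p = pr x (pr c p)" if "p \<in> part (A \<otimes> B) (k + l)" for p
      proof (rule tensor_part_eqI[where s = free_scale, OF _ _ that])
        fix j u v assume uv: "j \<le> k + l" "u \<in> part A j" "v \<in> part B (k + l - j)"
        have "right_rule A B \<tau> (k + l - j) l' 1" using Suc.prems by (intro one) simp
        with uv z have "\<tau> (tens B A v (c * x)) = pr x (\<tau> (tens B A v c))"
          by (auto simp: right_rule_def)
        then show "pr (c * x) (tens A B u v) = pr x (pr c (tens A B u v))"
          by (simp add: pr_tens pr_lact range)
      qed (intro linear_rules)+
      have "right_rule A B \<tau> k (l + l') 1" using Suc.prems by (intro one) simp
      then have "\<tau> (tens B A b ((a * c) * x)) = pr x (\<tau> (tens B A b (a * c)))"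
        using H z A.mult_part unfolding right_rule_def by blast
      also have "right_rule A B \<tau> k l l'" using Suc by simp
      then have "\<tau> (tens B A b (a * c)) = pr c (\<tau> (tens B A b a))"
        using H z unfolding right_rule_def by blast
      also have "pr x (pr c (\<tau> (tens B A b a))) = pr (c * x) (\<tau> (tens B A b a))"
        using Suc.prems by (intro pr[symmetric] \<tau>_tens_part H) simp
      finally show "\<tau> (tens B A b (a * z)) = pr z (\<tau> (tens B A b a))"
        by (simp add: z(1) mult.assoc)
    qed (intro linear_rules)+
  qed
qed

text \<open>Mirror image of the previous induction, now on the degree of the first factor. Its first
  letter is split off, since \<open>pl (x * c)\<close> applies \<open>pl c\<close> before
  \<open>pl x\<close>.\<close>

lemma left_rule_degree_one:
  assumes "connected_graded_algebra B" "one_generated B"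
    and one: "\<And>k l. 1 + k + l \<le> m \<Longrightarrow> left_rule A B \<tau> 1 k l"
  shows "k + k' + l \<le> m \<Longrightarrow> left_rule A B \<tau> k k' l"
proof (induction k arbitrary: k' l)
  case 0
  show ?case unfolding left_rule_def
  proof (intro ballI)
    fix b b' a assume H: "b \<in> part B 0" "b' \<in> part B k'" "a \<in> part A l"
    then obtain c where c: "b = smul B c 1"
      using connected_graded_algebra.connected[OF assms(1)] by auto
    have "\<tau> (tens B A (smul B c 1 * b') a) = free_scale c (\<tau> (tens B A (1 * b') a))"
      by (rule linear_scaleD[where f = "\<lambda>x. \<tau> (tens B A (x * b') a)"]) (intro linear_rules)
    also have "\<dots> = free_scale c (pl 1 (\<tau> (tens B A b' a)))"
      using 0 H by (simp add: B.mult_one_left pl_one[OF \<tau>_tens_part])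
    also have "\<dots> = pl (smul B c 1) (\<tau> (tens B A b' a))"
      by (rule linear_scaleD[where f = "\<lambda>x. pl x (\<tau> (tens B A b' a))", symmetric]) (intro linear_rules)
    finally show "\<tau> (tens B A (b * b') a) = pl b (\<tau> (tens B A b' a))" using c by simp
  qed
next
  case (Suc k)
  show ?case unfolding left_rule_def
  proof (intro ballI)
    fix b b' a assume H: "b \<in> part B (Suc k)" "b' \<in> part B k'" "a \<in> part A l"
    show "\<tau> (tens B A (b * b') a) = pl b (\<tau> (tens B A b' a))"
    proof (rule linear_eq_on_span[where ?s2.0 = free_scale, OF _ _ B.one_generated_part_Suc(2)[OF assms(2) H(1)]])
      fix z assume "z \<in> {x * b |b x. b \<in> part B k \<and> x \<in> part B 1}"
      then obtain c x where z: "z = x * c" "c \<in> part B k" "x \<in> part B 1" by blast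
      \<comment> \<open>On \<open>u \<otimes> v\<close> the degree-one rule is applied to
        \<open>x\<close>, \<open>c\<close> and \<open>u\<close>, where \<open>u\<close> has degree
        \<open>j\<close> at most \<open>k' + l\<close>; \<open>pl_ract\<close> carries
        \<open>v\<close> along.\<close>
      have pl: "pl (x * c) p = pl x (pl c p)" if "p \<in> part (A \<otimes> B) (k' + l)" for p
      proof (rule tensor_part_eqI[where s = free_scale, OF _ _ that])
        fix j u v assume uv: "j \<le> k' + l" "u \<in> part A j" "v \<in> part B (k' + l - j)"
        have "left_rule A B \<tau> 1 k j" using Suc.prems uv by (intro one) simp
        with uv z have "\<tau> (tens B A (x * c) u) = pl x (\<tau> (tens B A c u))"
          by (auto simp: left_rule_def)
        then show "pl (x * c) (tens A B u v) = pl x (pl c (tens A B u v))"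
          by (simp add: pl_tens pl_ract range)
      qed (intro linear_rules)+
      have "left_rule A B \<tau> 1 (k + k') l" using Suc.prems by (intro one) simp
      then have "\<tau> (tens B A (x * (c * b')) a) = pl x (\<tau> (tens B A (c * b') a))"
        using H z B.mult_part unfolding left_rule_def by blast
      also have "left_rule A B \<tau> k k' l" using Suc by simp
      then have "\<tau> (tens B A (c * b') a) = pl c (\<tau> (tens B A b' a))"
        using H z unfolding left_rule_def by blast
      also have "pl x (pl c (\<tau> (tens B A b' a))) = pl (x * c) (\<tau> (tens B A b' a))"
        using Suc.prems by (intro pl[symmetric] \<tau>_tens_part H) simp
      finally show "\<tau> (tens B A (z * b') a) = pl z (\<tau> (tens B A b' a))"
        by (simp add: z(1) mult.assoc)
    qed (intro linear_rules)+
  qed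
qed

lemma twisted_product_of_rules:
  assumes R: "\<And>k l l'. k + l + l' \<le> m \<Longrightarrow> right_rule A B \<tau> k l l'"
    and L: "\<And>k k' l. k + k' + l \<le> m \<Longrightarrow> left_rule A B \<tau> k k' l"
    and H: "b \<in> part B k" "b' \<in> part B k'" "a \<in> part A l" "a' \<in> part A l'"
    and m: "k + k' + l + l' \<le> m"
  shows "\<tau> (tens B A (b * b') (a * a')) = twisted_product A B \<tau> b b' a a'"
proof -
  have "right_rule A B \<tau> (k + k') l l'" using m by (intro R) simp
  then have "\<tau> (tens B A (b * b') (a * a')) = pr a' (\<tau> (tens B A (b * b') a))"
    using H B.mult_part unfolding right_rule_def by blast
  also have "left_rule A B \<tau> k k' l" using m by (intro L) simp
  then have "\<tau> (tens B A (b * b') a) = pl b (\<tau> (tens B A b' a))"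
    using H unfolding left_rule_def by blast
  \<comment> \<open>Both sides are linear in the output of \<open>b'\<close> passing
    \<open>a\<close>, so compare them on \<open>x \<otimes> y\<close>, where \<open>pl b\<close>
    yields \<open>\<tau> (tens B A b x)\<close> multiplied by \<open>y\<close> on the right.\<close>
  also have "pr a' (pl b (\<tau> (tens B A b' a))) = twisted_product A B \<tau> b b' a a'"
    unfolding twisted_product_def
  proof (rule tensor_part_eqI[where s = free_scale, OF _ _ \<tau>_tens_part[OF H(2,3)]])
    show "k' + l \<le> m" using m by simp
    fix i x y assume xy: "i \<le> k' + l" "x \<in> part A i" "y \<in> part B (k' + l - i)"
    \<comment> \<open>The second use of \<open>L\<close>: for \<open>q = u \<otimes> v\<close> the
      left side lets \<open>v * y\<close> pass \<open>a'\<close> in one go, the right side lets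
      \<open>y\<close> and then \<open>v\<close> pass. The total degree is
      \<open>k + k' + l + l' - j\<close>, hence at most \<open>m\<close>.\<close>
    have "pr a' (ract y q) = pass_both A B \<tau> q (\<tau> (tens B A y a'))"
      if "q \<in> part (A \<otimes> B) (k + i)" for q
    proof (rule tensor_part_eqI[where s = free_scale, OF _ _ that])
      fix j u v assume uv: "j \<le> k + i" "u \<in> part A j" "v \<in> part B (k + i - j)"
      have "left_rule A B \<tau> (k + i - j) (k' + l - i) l'" using m uv xy by (intro L) simp
      then have "\<tau> (tens B A (v * y) a') = pl v (\<tau> (tens B A y a'))"
        using uv xy H unfolding left_rule_def by blast
      then show "pr a' (ract y (tens A B u v)) =
          pass_both A B \<tau> (tens A B u v) (\<tau> (tens B A y a'))"
        by (simp add: ract_tens pr_tens both_tens_left range)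
    qed (intro linear_rules)+
    moreover have "\<tau> (tens B A b x) \<in> part (A \<otimes> B) (k + i)"
      using m xy by (intro \<tau>_tens_part H) simp_all
    ultimately show "pr a' (pl b (tens A B x y)) =
        tensor_lift free_scale (\<lambda>x y. pass_both A B \<tau> (\<tau> (tens B A b x)) (\<tau> (tens B A y a')))
          (tens A B x y)"
      by (simp add: pl_tens twisted_product_lift)
  qed (intro linear_rules linear_lift_arg)+
  finally show ?thesis .
qed

end

text \<open>The rule evaluates its map only in degrees at most \<open>k + l + l'\<close>; inside
  \<open>pass_right\<close> this is because \<open>v\<close> in \<open>v \<otimes> a'\<close> has
  degree at most \<open>k + l\<close>. It can thus be moved between truncations taken at different
  degrees.\<close>

lemma right_rule_transfer:
  assumes "unital_exchange_map A B \<tau> m" "unital_exchange_map A B \<tau>' m"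
    and eq: "\<And>j x. j \<le> m \<Longrightarrow> x \<in> part (B \<otimes> A) j \<Longrightarrow> \<tau> x = \<tau>' x"
    and "k + l + l' \<le> m" "right_rule A B \<tau> k l l'"
  shows "right_rule A B \<tau>' k l l'"
  unfolding right_rule_def
proof (intro ballI)
  interpret S: unital_exchange_map A B \<tau> m by fact
  interpret T: unital_exchange_map A B \<tau>' m by fact
  fix b a a' assume H: "b \<in> part B k" "a \<in> part A l" "a' \<in> part A l'"
  have eqt: "\<tau> (tens B A b a) = \<tau>' (tens B A b a)"
    if "b \<in> part B i" "a \<in> part A j" "i + j \<le> m" for i j b a
    using that by (auto intro!: eq tens_in_part)
  have "S.pr a' p = T.pr a' p" if "p \<in> part (A \<otimes> B) (k + l)" for p
  proof (rule tensor_part_eqI[where s = free_scale, OF _ _ that])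
    fix j u v assume uv: "j \<le> k + l" "u \<in> part A j" "v \<in> part B (k + l - j)"
    then have "\<tau> (tens B A v a') = \<tau>' (tens B A v a')"
      using assms(4) by (intro eqt[OF uv(3) H(3)]) simp
    then show "S.pr a' (tens A B u v) = T.pr a' (tens A B u v)"
      by (simp add: S.pr_tens T.pr_tens)
  qed (intro S.linear_rules T.linear_rules)+
  note this[OF S.\<tau>_tens_part[OF H(1,2)]]
  moreover have "a * a' \<in> part A (l + l')" using H by (intro S.A.mult_part)
  ultimately show "\<tau>' (tens B A b (a * a')) = T.pr a' (\<tau>' (tens B A b a))"
    using assms(4,5) H eqt[OF H(1,2)] eqt[of b k "a * a'" "l + l'"]
    by (auto simp: right_rule_def)
qed

lemma left_rule_transfer:
  assumes "unital_exchange_map A B \<tau> m" "unital_exchange_map A B \<tau>' m"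
    and eq: "\<And>j x. j \<le> m \<Longrightarrow> x \<in> part (B \<otimes> A) j \<Longrightarrow> \<tau> x = \<tau>' x"
    and "k + k' + l \<le> m" "left_rule A B \<tau> k k' l"
  shows "left_rule A B \<tau>' k k' l"
  unfolding left_rule_def
proof (intro ballI)
  interpret S: unital_exchange_map A B \<tau> m by fact
  interpret T: unital_exchange_map A B \<tau>' m by fact
  fix b b' a assume H: "b \<in> part B k" "b' \<in> part B k'" "a \<in> part A l"
  have eqt: "\<tau> (tens B A b a) = \<tau>' (tens B A b a)"
    if "b \<in> part B i" "a \<in> part A j" "i + j \<le> m" for i j b a
    using that by (auto intro!: eq tens_in_part)
  have "S.pl b p = T.pl b p" if "p \<in> part (A \<otimes> B) (k' + l)" for p
  proof (rule tensor_part_eqI[where s = free_scale, OF _ _ that])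
    fix j u v assume uv: "j \<le> k' + l" "u \<in> part A j" "v \<in> part B (k' + l - j)"
    then have "\<tau> (tens B A b u) = \<tau>' (tens B A b u)"
      using assms(4) by (intro eqt[OF H(1) uv(2)]) simp
    then show "S.pl b (tens A B u v) = T.pl b (tens A B u v)"
      by (simp add: S.pl_tens T.pl_tens)
  qed (intro S.linear_rules T.linear_rules)+
  note this[OF S.\<tau>_tens_part[OF H(2,3)]]
  moreover have "b * b' \<in> part B (k + k')" using H by (intro S.B.mult_part)
  ultimately show "\<tau>' (tens B A (b * b') a) = T.pl b (\<tau>' (tens B A b' a))"
    using assms(4,5) H eqt[OF H(2,3)] eqt[of "b * b'" "k + k'" a l]
    by (auto simp: left_rule_def)
qed

section \<open>Truncations\<close>

lemma tens_in_part_upto: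
  assumes "v \<in> part V k" "w \<in> part W l" "k + l \<le> m"
  shows "tens V W v w \<in> part_upto (V \<otimes> W) m"
proof -
  interpret F: vector_space "free_scale" by (rule vector_space_free_scale)
  show ?thesis
    unfolding part_upto_def smul_tensor
    by (rule F.span_base) (use assms tens_in_part[OF assms(1,2) refl] in blast)
qed

lemma part_subset_part_upto: "i \<le> m \<Longrightarrow> part (V \<otimes> W) i \<subseteq> part_upto (V \<otimes> W) m"
proof -
  interpret F: vector_space "free_scale" by (rule vector_space_free_scale)
  show "i \<le> m \<Longrightarrow> part (V \<otimes> W) i \<subseteq> part_upto (V \<otimes> W) m"
    unfolding part_upto_def smul_tensor by (auto intro: F.span_base)
qed

text \<open>A truncation at \<open>i\<close> consults \<open>t\<close> only on products of
  components of total degree at most \<open>i\<close>, so the undefined values of the restriction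
  never enter.\<close>

lemma truncation_restrict:
  assumes "graded_algebra A" "graded_algebra B" "i \<le> m"
  shows "truncation B A i (restrict t (part_upto (B \<otimes> A) m)) = truncation B A i t"
proof -
  interpret A: graded_algebra A by fact
  interpret B: graded_algebra B by fact
  have "tens B A (component B k b) (component A l a) \<in> part_upto (B \<otimes> A) m"
    if "k \<le> i" "l \<le> i - k" for k l a b
    by (rule tens_in_part_upto[OF B.component_decomposition(1) A.component_decomposition(1)])
       (use that assms(3) in simp)
  then show ?thesis by (simp add: truncation_def)
qed

lemma truncation_unital_exchange_map:
  assumes "graded_algebra A" "graded_algebra B"
    and t: "graded_linear_upto (B \<otimes> A) (A \<otimes> B) m t" and u: "unital_upto B A m t" and "i \<le> m"
  shows "unital_exchange_map A B (truncation B A i t) i"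
proof -
  interpret A: graded_algebra A by fact
  interpret B: graded_algebra B by fact
  have eq: "truncation B A i t x = t x" if "j \<le> i" "x \<in> part (B \<otimes> A) j" for j x
    using that assms by (intro truncation_part[OF _ _ t]) auto
  have tpart: "t x \<in> part (A \<otimes> B) j" if "j \<le> i" "x \<in> part (B \<otimes> A) j" for j x
    using t that \<open>i \<le> m\<close> by (auto simp: graded_linear_upto_def image_subset_iff)
  have one: "tens B A 1 a \<in> part (B \<otimes> A) k" if "a \<in> part A k" for a k
    using that by (intro tens_in_part[OF B.one_part]) auto
  have one': "tens B A b 1 \<in> part (B \<otimes> A) k" if "b \<in> part B k" for b k
    using that by (intro tens_in_part[OF _ A.one_part]) auto
  interpret F: vector_space free_scale by (rule vector_space_free_scale)
  show ?thesis
  proof (intro unital_exchange_map.intro exchange_map.intro unital_exchange_map_axioms.intro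
      exchange_map_axioms.intro assms(1,2))
    show "Vector_Spaces.linear free_scale free_scale (truncation B A i t)"
      unfolding truncation_def by (rule linear_tensor_lift[OF vector_space_free_scale])
    \<comment> \<open>The range condition concerns every formal combination \<open>p\<close>, so it
      is read off the sum defining \<open>tensor_lift\<close>, whose terms are built from values of
      \<open>t\<close> in degrees at most \<open>i\<close>.\<close>
    have "t (tens B A (component B k b) (component A l a)) \<in> tens_span A B"
      if "k \<le> i" "l \<le> i - k" for k l a b
    proof -
      have "tens B A (component B k b) (component A l a) \<in> part (B \<otimes> A) (k + l)"
        by (rule tens_in_part[OF B.component_decomposition(1) A.component_decomposition(1) refl])
      then have "t (tens B A (component B k b) (component A l a)) \<in> part (A \<otimes> B) (k + l)"
        by (rule tpart[rotated]) (use that in simp)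
      then show ?thesis using tensor_part_subset_tens_span by blast
    qed
    then show "truncation B A i t p \<in> tens_span A B" for p
      unfolding truncation_def tensor_lift_def free_extend_def
      by (auto intro!: F.subspace_sum F.subspace_scale subspace_tens_span)
    show "truncation B A i t x \<in> part (A \<otimes> B) j" if "j \<le> i" "x \<in> part (B \<otimes> A) j" for j x
      using eq tpart that by simp
    show "truncation B A i t (tens B A 1 a) = tens A B a 1" if "k \<le> i" "a \<in> part A k" for k a
      using eq[OF that(1) one[OF that(2)]] u that(2) le_trans[OF that(1) \<open>i \<le> m\<close>]
      by (auto simp: unital_upto_def)
    show "truncation B A i t (tens B A b 1) = tens A B 1 b" if "k \<le> i" "b \<in> part B k" for k b
      using eq[OF that(1) one'[OF that(2)]] u that(2) le_trans[OF that(1) \<open>i \<le> m\<close>]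
      by (auto simp: unital_upto_def)
  qed
qed

text \<open>\<open>tens\<close> depends on the scalings and not on the grading. Passing to
  \<open>degree_one_part\<close> shrinks the domain of hypotheses (2) and (3) but leaves the tensors
  themselves unchanged.\<close>

lemma tens_degree_one_part: "tens V (degree_one_part W) = tens V W" "tens (degree_one_part V) W = tens V W"
  by (simp_all add: tens_def tensor_relations_def degree_one_part_def fun_eq_iff)

lemma tens_tensor_degree_one_part:
  "tens U (V \<otimes> degree_one_part W) = tens U (V \<otimes> W)"
  "tens (degree_one_part U \<otimes> V) W = tens (U \<otimes> V) W"
  by (simp_all add: tens_def tensor_relations_def fun_eq_iff)

lemma tensor4_part_eqI:
  assumes f: "Vector_Spaces.linear free_scale s f" and g: "Vector_Spaces.linear free_scale s g"
    and p: "p \<in> part ((V \<otimes> V') \<otimes> (W \<otimes> W')) m"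
    and eq: "\<And>k k' l l' v v' w w'. k + k' + l + l' = m \<Longrightarrow> v \<in> part V k \<Longrightarrow> v' \<in> part V' k' \<Longrightarrow>
      w \<in> part W l \<Longrightarrow> w' \<in> part W' l' \<Longrightarrow>
      f (tens (V \<otimes> V') (W \<otimes> W') (tens V V' v v') (tens W W' w w')) =
      g (tens (V \<otimes> V') (W \<otimes> W') (tens V V' v v') (tens W W' w w'))"
  shows "f p = g p"
proof (rule tensor_part_eqI[OF f g p])
  fix k q r assume q: "k \<le> m" "q \<in> part (V \<otimes> V') k" and r: "r \<in> part (W \<otimes> W') (m - k)"
  show "f (tens (V \<otimes> V') (W \<otimes> W') q r) = g (tens (V \<otimes> V') (W \<otimes> W') q r)"
  proof (rule tensor_part_eqI[OF _ _ q(2)])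
    fix i v v' assume v: "i \<le> k" "v \<in> part V i" "v' \<in> part V' (k - i)"
    show "f (tens (V \<otimes> V') (W \<otimes> W') (tens V V' v v') r) = g (tens (V \<otimes> V') (W \<otimes> W') (tens V V' v v') r)"
    proof (rule tensor_part_eqI[OF _ _ r])
      fix j w w' assume w: "j \<le> m - k" "w \<in> part W j" "w' \<in> part W' (m - k - j)"
      show "f (tens (V \<otimes> V') (W \<otimes> W') (tens V V' v v') (tens W W' w w')) =
        g (tens (V \<otimes> V') (W \<otimes> W') (tens V V' v v') (tens W W' w w'))"
        by (rule eq[OF _ v(2,3) w(2,3)]) (use q v w in simp)
    qed (rule linear_comp[OF f] linear_comp[OF g], intro linear_intros)+
  qed (rule linear_comp[OF f] linear_comp[OF g], intro linear_intros)+
qed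

section \<open>The passage from degree \<open>n\<close> to degree \<open>n + 1\<close>\<close>

theorem theorem3p2:
  fixes A :: "('k::field, 'a::{ring, one}) graded_space"
    and B :: "('k, 'b::{ring, one}) graded_space"
    and n :: nat
    and t :: "('b \<times> 'a \<Rightarrow>\<^sub>0 'k) \<Rightarrow> ('a \<times> 'b \<Rightarrow>\<^sub>0 'k)"
  assumes "connected_graded_algebra A" and "one_generated A"
    and "connected_graded_algebra B" and "one_generated B"
    and "n > 0"
    and "graded_linear_upto (B \<otimes> A) (A \<otimes> B) (n + 1) t"
    and "unital_upto B A (n + 1) t"
    and "graded_twisting B A n (restrict t (part_upto (B \<otimes> A) n))"
    and "\<forall>x\<in>part (B \<otimes> (A \<otimes> degree_one_part A)) (n + 1).
      t (tensor_map B A id (mult_map A) x) =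
      (tensor_map A B (mult_map A) id \<circ> assoc_left A A B \<circ>
       tensor_map A (A \<otimes> B) id (truncation B A (n + 1) t) \<circ> assoc_right A B A \<circ>
       tensor_map (A \<otimes> B) A (truncation B A (n + 1) t) id \<circ> assoc_left B A A) x"
    and "\<forall>x\<in>part ((degree_one_part B \<otimes> B) \<otimes> A) (n + 1).
      t (tensor_map B A (mult_map B) id x) =
      (tensor_map A B id (mult_map B) \<circ> assoc_right A B B \<circ>
       tensor_map (A \<otimes> B) B (truncation B A (n + 1) t) id \<circ> assoc_left B A B \<circ>
       tensor_map B (A \<otimes> B) id (truncation B A (n + 1) t) \<circ> assoc_right B B A) x"
  shows "graded_twisting B A (n + 1) t"
proof -
  interpret CA: connected_graded_algebra A by fact
  interpret CB: connected_graded_algebra B by fact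
  note gA = CA.graded_algebra_axioms and gB = CB.graded_algebra_axioms
  note t = assms(6) and u = assms(7)
  \<comment> \<open>A total linear map that agrees with \<open>t\<close> up to degree
    \<open>n + 1\<close>; it is also the map occurring in hypotheses (2) and (3).\<close>
  define \<tau> where "\<tau> = truncation B A (n + 1) t"
  interpret E: unital_exchange_map A B \<tau> "n + 1"
    unfolding \<tau>_def by (rule truncation_unital_exchange_map[OF gA gB t u]) simp
  have trunc: "truncation B A i t x = t x" if "j \<le> i" "i \<le> n + 1" "x \<in> part (B \<otimes> A) j" for i j x
    using that by (intro truncation_part[OF gB gA t]) auto
  have mult_part: "tensor_map B A (mult_map B) (mult_map A) x \<in> part (B \<otimes> A) i"
    if "x \<in> part ((B \<otimes> B) \<otimes> (A \<otimes> A)) i" for x i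
    using that CA.linear_mult_map CB.linear_mult_map
    by (intro tensor_map_part) (auto intro: CA.mult_map_part CB.mult_map_part)
  have mult_tens: "tensor_map B A (mult_map B) (mult_map A)
      (tens (B \<otimes> B) (A \<otimes> A) (tens B B b b') (tens A A a a')) = tens B A (b * b') (a * a')" for a a' b b'
    using tensor_map_tens[of "B \<otimes> B" B "mult_map B" "A \<otimes> A" A "mult_map A"]
    by (simp add: CA.linear_mult_map CB.linear_mult_map mult_map_tens gA gB)
  have twisting: "t (tensor_map B A (mult_map B) (mult_map A) x) =
        (tensor_map A B (mult_map A) (mult_map B) \<circ>
         tensor_middle A B A B (truncation B A i t) \<circ>
         tensor_map (A \<otimes> B) (A \<otimes> B) (truncation B A i t) (truncation B A i t) \<circ>
         tensor_middle B B A A (truncation B A i t)) x"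
    if i: "i \<le> n" and x: "x \<in> part ((B \<otimes> B) \<otimes> (A \<otimes> A)) i" for i x
  proof -
    let ?t = "restrict t (part_upto (B \<otimes> A) n)"
    have "?t (tensor_map B A (mult_map B) (mult_map A) x) =
        (tensor_map A B (mult_map A) (mult_map B) \<circ>
         tensor_middle A B A B (truncation B A i ?t) \<circ>
         tensor_map (A \<otimes> B) (A \<otimes> B) (truncation B A i ?t) (truncation B A i ?t) \<circ>
         tensor_middle B B A A (truncation B A i ?t)) x"
      using assms(8) i x unfolding graded_twisting_def by blast
    moreover have "tensor_map B A (mult_map B) (mult_map A) x \<in> part_upto (B \<otimes> A) n"
      using mult_part[OF x] part_subset_part_upto[OF i] by blast
    ultimately show ?thesis by (simp add: truncation_restrict[OF gA gB i])
  qed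
  have low: "truncation B A i t (tens B A (b * b') (a * a')) =
      twisted_product A B (truncation B A i t) b b' a a'"
    if H: "b \<in> part B k" "b' \<in> part B k'" "a \<in> part A l" "a' \<in> part A l'"
      and i: "k + k' + l + l' = i" "i \<le> n" for i k k' l l' a a' b b'
  proof -
    interpret I: unital_exchange_map A B "truncation B A i t" i
      by (rule truncation_unital_exchange_map[OF gA gB t u]) (use i in simp)
    have x: "tens (B \<otimes> B) (A \<otimes> A) (tens B B b b') (tens A A a a') \<in> part ((B \<otimes> B) \<otimes> (A \<otimes> A)) i"
      using i by (intro tens_in_part[where k = "k + k'" and l = "l + l'"]
          tens_in_part[OF H(1,2)] tens_in_part[OF H(3,4)]) auto
    show ?thesis
      using twisting[OF i(2) x] trunc[OF order_refl _ mult_part[OF x]] i(2)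
      unfolding I.twisting_composite mult_tens by simp
  qed
  \<comment> \<open>In degree \<open>i\<close> the twisting axiom involves the truncation at
    \<open>i\<close>. These facts allow its consequences to be moved to the single map
    \<open>\<tau>\<close>.\<close>
  have transfer: "unital_exchange_map A B (truncation B A i t) i" "unital_exchange_map A B \<tau> i"
    "j \<le> i \<Longrightarrow> x \<in> part (B \<otimes> A) j \<Longrightarrow> truncation B A i t x = \<tau> x" if "i \<le> n" for i j x
  proof -
    show "unital_exchange_map A B (truncation B A i t) i"
      by (rule truncation_unital_exchange_map[OF gA gB t u]) (use that in simp)
    show "unital_exchange_map A B \<tau> i"
      by unfold_locales
         (use that E.graded in simp, erule E.unital_left[rotated], use that in simp,
          erule E.unital_right[rotated], use that in simp)
    show "j \<le> i \<Longrightarrow> x \<in> part (B \<otimes> A) j \<Longrightarrow> truncation B A i t x = \<tau> x"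
      using that trunc[of j i x] trunc[of j "n + 1" x] by (simp add: \<tau>_def)
  qed
  \<comment> \<open>In total degree at most \<open>n\<close> this follows from hypothesis (1) with
    \<open>b' = 1\<close>; in total degree \<open>n + 1\<close> it is hypothesis (2) on a pure
    tensor.\<close>
  have right_one: "right_rule A B \<tau> k l 1" if "k + l + 1 \<le> n + 1" for k l
  proof (cases "k + l + 1 \<le> n")
    case True
    note tr = transfer[OF True]
    have "right_rule A B (truncation B A (k + l + 1) t) k l 1"
      by (rule unital_exchange_map.right_rule_of_twisted_product[OF tr(1)])
         (rule low[where k = k and k' = 0 and l = l and l' = 1], use True in simp_all)
    from right_rule_transfer[OF tr(1,2) tr(3) _ this] show ?thesis by simp
  next
    case False
    with that have n: "k + (l + 1) = n + 1" by simp
    show ?thesis unfolding right_rule_def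
    proof (intro ballI)
      fix b a x assume H: "b \<in> part B k" "a \<in> part A l" "x \<in> part A 1"
      have "x \<in> part (degree_one_part A) 1" using H by (simp add: degree_one_part_def)
      from tens_in_part[OF H(1) tens_in_part[OF H(2) this refl] n]
      have y: "tens B (A \<otimes> A) b (tens A A a x) \<in> part (B \<otimes> (A \<otimes> degree_one_part A)) (n + 1)"
        by (simp only: tens_degree_one_part tens_tensor_degree_one_part)
      have "tens B A b (a * x) \<in> part (B \<otimes> A) (n + 1)"
        by (rule tens_in_part[OF H(1) CA.mult_part[OF H(2,3)] n])
      then have "\<tau> (tens B A b (a * x)) = t (tens B A b (a * x))"
        unfolding \<tau>_def by (intro trunc) auto
      also have "\<dots> = E.pr x (\<tau> (tens B A b a))"
        using bspec[OF assms(9) y] unfolding \<tau>_def[symmetric] E.right_composite E.mult_A_map_tens .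
      finally show "\<tau> (tens B A b (a * x)) = E.pr x (\<tau> (tens B A b a))" .
    qed
  qed
  \<comment> \<open>Likewise from hypothesis (1) with inner \<open>A\<close>-factor
    \<open>1\<close>, and from hypothesis (3) in the top degree.\<close>
  have left_one: "left_rule A B \<tau> 1 k l" if "1 + k + l \<le> n + 1" for k l
  proof (cases "1 + k + l \<le> n")
    case True
    note tr = transfer[OF True]
    have "left_rule A B (truncation B A (1 + k + l) t) 1 k l"
      by (rule unital_exchange_map.left_rule_of_twisted_product[OF tr(1)])
         (rule low[where k = 1 and k' = k and l = 0 and l' = l], use True in simp_all)
    from left_rule_transfer[OF tr(1,2) tr(3) _ this] show ?thesis by simp
  next
    case False
    with that have n: "(1 + k) + l = n + 1" by simp
    show ?thesis unfolding left_rule_def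
    proof (intro ballI)
      fix x b a assume H: "x \<in> part B 1" "b \<in> part B k" "a \<in> part A l"
      have "x \<in> part (degree_one_part B) 1" using H by (simp add: degree_one_part_def)
      from tens_in_part[OF tens_in_part[OF this H(2) refl] H(3) n]
      have y: "tens (B \<otimes> B) A (tens B B x b) a \<in> part ((degree_one_part B \<otimes> B) \<otimes> A) (n + 1)"
        by (simp only: tens_degree_one_part tens_tensor_degree_one_part)
      have "tens B A (x * b) a \<in> part (B \<otimes> A) (n + 1)"
        by (rule tens_in_part[OF CB.mult_part[OF H(1,2)] H(3) n])
      then have "\<tau> (tens B A (x * b) a) = t (tens B A (x * b) a)"
        unfolding \<tau>_def by (intro trunc) auto
      also have "\<dots> = E.pl x (\<tau> (tens B A b a))"
        using bspec[OF assms(10) y] unfolding \<tau>_def[symmetric] E.left_composite E.mult_B_map_tens .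
      finally show "\<tau> (tens B A (x * b) a) = E.pl x (\<tau> (tens B A b a))" .
    qed
  qed
  \<comment> \<open>One-generation extends both rules from a degree-one factor to all total degrees
    at most \<open>n + 1\<close>; together they give the twisting axiom in degree
    \<open>n + 1\<close>.\<close>
  note right = E.right_rule_degree_one[OF assms(1,2) right_one]
    and left = E.left_rule_degree_one[OF assms(3,4) left_one]
  have top: "t (tensor_map B A (mult_map B) (mult_map A) x) =
      (tensor_map A B (mult_map A) (mult_map B) \<circ> tensor_middle A B A B \<tau> \<circ>
       tensor_map (A \<otimes> B) (A \<otimes> B) \<tau> \<tau> \<circ> tensor_middle B B A A \<tau>) x"
    if x: "x \<in> part ((B \<otimes> B) \<otimes> (A \<otimes> A)) (n + 1)" for x
  proof -
    have "t (tensor_map B A (mult_map B) (mult_map A) x) =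
        \<tau> (tensor_map B A (mult_map B) (mult_map A) x)"
      unfolding \<tau>_def by (rule trunc[OF _ _ mult_part[OF x], symmetric]) auto
    also have "\<dots> = (tensor_map A B (mult_map A) (mult_map B) \<circ> tensor_middle A B A B \<tau> \<circ>
       tensor_map (A \<otimes> B) (A \<otimes> B) \<tau> \<tau> \<circ> tensor_middle B B A A \<tau>) x"
    proof (rule tensor4_part_eqI[where s = free_scale, OF _ _ x])
      fix k k' l l' b b' a a'
      assume "k + k' + l + l' = n + 1" "b \<in> part B k" "b' \<in> part B k'" "a \<in> part A l" "a' \<in> part A l'"
      then have "\<tau> (tens B A (b * b') (a * a')) = twisted_product A B \<tau> b b' a a'"
        by (intro E.twisted_product_of_rules right left) auto
      then show "\<tau> (tensor_map B A (mult_map B) (mult_map A)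
            (tens (B \<otimes> B) (A \<otimes> A) (tens B B b b') (tens A A a a'))) =
          (tensor_map A B (mult_map A) (mult_map B) \<circ> tensor_middle A B A B \<tau> \<circ>
           tensor_map (A \<otimes> B) (A \<otimes> B) \<tau> \<tau> \<circ> tensor_middle B B A A \<tau>)
            (tens (B \<otimes> B) (A \<otimes> A) (tens B B b b') (tens A A a a'))"
        unfolding E.twisting_composite mult_tens .
    qed (unfold o_def, (intro E.linear_rules)+)
    finally show ?thesis .
  qed
  show ?thesis
    unfolding graded_twisting_def
  proof (intro conjI allI impI ballI)
    fix i x assume "i \<le> n + 1" and x: "x \<in> part ((B \<otimes> B) \<otimes> (A \<otimes> A)) i"
    then consider "i \<le> n" | "i = n + 1" by linarith
    then show "t (tensor_map B A (mult_map B) (mult_map A) x) =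
        (tensor_map A B (mult_map A) (mult_map B) \<circ>
         tensor_middle A B A B (truncation B A i t) \<circ>
         tensor_map (A \<otimes> B) (A \<otimes> B) (truncation B A i t) (truncation B A i t) \<circ>
         tensor_middle B B A A (truncation B A i t)) x"
      by cases (use twisting x top in \<open>simp_all only: \<tau>_def\<close>)
  qed (rule t u)+
qed

end
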